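(* Let $\mathcal A$ and $\mathcal B$ be limit algebras and let $\varphi:\mathcal A\to\mathcal B$ be an algebraic isomorphism. Then $\varphi$ is continuous (with respect to the norm topologies).
   Context: For an AF $C^*$-algebra $\mathcal C$ and subalgebras $X,Y\subseteq\mathcal C$, the normalizer of $Y$ in $X$ is $N_Y(X)=\{x\in X : x \text{ is a partial isometry and } xyx^*,x^*yx\in Y \text{ for all } y\in Y\}$. A maximal abelian selfadjoint subalgebra (masa) $\mathcal D$ of $\mathcal C$ is a canonical masa in $\mathcal C$ if there is a nested sequence $(C_k)_k$ of finite dimensional $C^*$-subalgebras of $\mathcal C$ with $\mathcal C=\overline{\bigcup_k C_k}$ such that, with $D_k=C_k\cap\mathcal D$, each $D_k$ is a masa in $C_k$, $\mathcal D=\overline{\bigcup_k D_k}$, and $N_{D_k}(C_k)\subseteq N_{D_{k+1}}(C_{k+1})$ for all $k$. A limit algebra (regular canonical subalgebra) is a norm-closed subalgebra of an AF $C^*$-algebra $\mathcal C$ that contains a canonical masa in $\mathcal C$. An algebraic isomorphism is a bijective homomorphism of complex algebras; it is not assumed to be continuous. *)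

theory Defs
  imports "HOL-Analysis.Analysis"
begin

text \<open>
  Abstract C*-algebras, complete by \<^class>\<open>banach\<close> and not assumed unital.  The real scalar
  multiplication carried by the library classes is the restriction of the complex one.
\<close>

class cstar_algebra = real_normed_algebra + banach +
  fixes scaleC :: "complex \<Rightarrow> 'a \<Rightarrow> 'a" (infixr "*\<^sub>C" 75)
    and star :: "'a \<Rightarrow> 'a"
  assumes scaleC_of_real: "complex_of_real r *\<^sub>C x = r *\<^sub>R x"
    and scaleC_add_right: "a *\<^sub>C (x + y) = a *\<^sub>C x + a *\<^sub>C y"
    and scaleC_add_left: "(a + b) *\<^sub>C x = a *\<^sub>C x + b *\<^sub>C x"
    and scaleC_scaleC: "a *\<^sub>C (b *\<^sub>C x) = (a * b) *\<^sub>C x"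
    and mult_scaleC_left: "(a *\<^sub>C x) * y = a *\<^sub>C (x * y)"
    and mult_scaleC_right: "x * (a *\<^sub>C y) = a *\<^sub>C (x * y)"
    and norm_scaleC: "norm (a *\<^sub>C x) = cmod a * norm x"
    and star_add: "star (x + y) = star x + star y"
    and star_scaleC: "star (a *\<^sub>C x) = cnj a *\<^sub>C star x"
    and star_mult: "star (x * y) = star y * star x"
    and star_star: "star (star x) = x"
    and cstar_identity: "norm (star x * x) = (norm x)\<^sup>2"

lemma scaleC_one: "1 *\<^sub>C x = (x :: 'a::cstar_algebra)"
  using scaleC_of_real[of 1 x] by simp

global_interpretation complex_vector: vector_space "scaleC :: complex \<Rightarrow> 'a \<Rightarrow> 'a::cstar_algebra"
  by unfold_locales (simp_all add: scaleC_add_right scaleC_add_left scaleC_scaleC scaleC_one)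

instantiation complex :: cstar_algebra
begin

definition scaleC_complex :: "complex \<Rightarrow> complex \<Rightarrow> complex" where "scaleC_complex a x = a * x"
definition star_complex :: "complex \<Rightarrow> complex" where "star_complex = cnj"

instance
  by standard
    (simp_all add: scaleC_complex_def star_complex_def algebra_simps norm_mult
      power2_eq_square scaleR_conv_of_real)

end

text \<open>
  All algebras below are subsets of an ambient C*-algebra given by a type.
\<close>

definition complex_subalgebra :: "'a::cstar_algebra set \<Rightarrow> bool" where
  "complex_subalgebra A \<longleftrightarrow> complex_vector.subspace A \<and> (\<forall>x\<in>A. \<forall>y\<in>A. x * y \<in> A)"

definition star_subalgebra :: "'a::cstar_algebra set \<Rightarrow> bool" where
  "star_subalgebra A \<longleftrightarrow> complex_subalgebra A \<and> (\<forall>x\<in>A. star x \<in> A)"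

definition cstar_subalgebra :: "'a::cstar_algebra set \<Rightarrow> bool" where
  "cstar_subalgebra A \<longleftrightarrow> star_subalgebra A \<and> closed A"

definition finite_dimensional :: "'a::cstar_algebra set \<Rightarrow> bool" where
  "finite_dimensional V \<longleftrightarrow> (\<exists>S. finite S \<and> V \<subseteq> complex_vector.span S)"

definition abelian :: "'a::cstar_algebra set \<Rightarrow> bool" where
  "abelian A \<longleftrightarrow> (\<forall>x\<in>A. \<forall>y\<in>A. x * y = y * x)"

definition masa :: "'a::cstar_algebra set \<Rightarrow> 'a set \<Rightarrow> bool" where
  "masa D C \<longleftrightarrow> D \<subseteq> C \<and> star_subalgebra D \<and> abelian D \<and>
     (\<forall>E. E \<subseteq> C \<and> star_subalgebra E \<and> abelian E \<and> D \<subseteq> E \<longrightarrow> E = D)"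

definition partial_isometry :: "'a::cstar_algebra \<Rightarrow> bool" where
  "partial_isometry x \<longleftrightarrow> x * star x * x = x"

definition normalizer :: "'a::cstar_algebra set \<Rightarrow> 'a set \<Rightarrow> 'a set" where
  "normalizer Y X =
     {x \<in> X. partial_isometry x \<and> (\<forall>y\<in>Y. x * y * star x \<in> Y \<and> star x * y * x \<in> Y)}"

definition AF_sequence :: "(nat \<Rightarrow> 'a::cstar_algebra set) \<Rightarrow> 'a set \<Rightarrow> bool" where
  "AF_sequence Ck C \<longleftrightarrow>
     (\<forall>k. cstar_subalgebra (Ck k) \<and> finite_dimensional (Ck k)) \<and>
     (\<forall>k. Ck k \<subseteq> Ck (Suc k)) \<and> C = closure (\<Union>k. Ck k)"

definition AF_algebra :: "'a::cstar_algebra set \<Rightarrow> bool" where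
  "AF_algebra C \<longleftrightarrow> cstar_subalgebra C \<and> (\<exists>Ck. AF_sequence Ck C)"

definition canonical_masa :: "'a::cstar_algebra set \<Rightarrow> 'a set \<Rightarrow> bool" where
  "canonical_masa D C \<longleftrightarrow> masa D C \<and>
     (\<exists>Ck. AF_sequence Ck C \<and>
       (\<forall>k. masa (Ck k \<inter> D) (Ck k)) \<and>
       D = closure (\<Union>k. Ck k \<inter> D) \<and>
       (\<forall>k. normalizer (Ck k \<inter> D) (Ck k) \<subseteq> normalizer (Ck (Suc k) \<inter> D) (Ck (Suc k))))"

definition limit_algebra :: "'a::cstar_algebra set \<Rightarrow> bool" where
  "limit_algebra A \<longleftrightarrow> complex_subalgebra A \<and> closed A \<and>
     (\<exists>C D. AF_algebra C \<and> A \<subseteq> C \<and> canonical_masa D C \<and> D \<subseteq> A)"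

definition algebraic_isomorphism ::
  "('a::cstar_algebra \<Rightarrow> 'b::cstar_algebra) \<Rightarrow> 'a set \<Rightarrow> 'b set \<Rightarrow> bool" where
  "algebraic_isomorphism \<phi> A B \<longleftrightarrow> bij_betw \<phi> A B \<and>
     (\<forall>x\<in>A. \<forall>y\<in>A. \<phi> (x + y) = \<phi> x + \<phi> y \<and> \<phi> (x * y) = \<phi> x * \<phi> y) \<and>
     (\<forall>c. \<forall>x\<in>A. \<phi> (c *\<^sub>C x) = c *\<^sub>C \<phi> x)"

end

theory Submission
  imports Defs "HOL-Computational_Algebra.Fundamental_Theorem_Algebra"
begin

text \<open>
  By the closed graph theorem, \<open>\<phi>\<close> is continuous as soon as its separating space is zero, that is, as
  soon as \<open>x\<^sub>n \<longlonglongrightarrow> 0\<close> and \<open>\<phi> x\<^sub>n \<longlonglongrightarrow> s\<close> force \<open>s = 0\<close>.  The separating space is stable under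
  multiplication by \<open>B\<close> on both sides, in particular under compressions \<open>s \<mapsto> q s p\<close> by projections
  of the diagonal \<open>D \<subseteq> B\<close>.  Write \<open>D\<^sub>k = C\<^sub>k \<inter> D\<close> for a sequence \<open>C\<^sub>k\<close> of finite dimensional algebras
  defining the canonical masa.  Two facts about these compressions contradict each other when
  \<open>s \<noteq> 0\<close>.

  The first is a gliding hump (\<open>gliding_hump\<close>).  If \<open>q\<^sub>n s p\<^sub>n \<noteq> 0\<close> held for infinitely many pairs of
  projections that are pairwise orthogonal on at least one side, then the corner of \<open>A\<close> cut out by the
  idempotents \<open>\<phi>\<^sup>-\<^sup>1 q\<^sub>n\<close> and \<open>\<phi>\<^sup>-\<^sup>1 p\<^sub>n\<close> would contain a tiny element with a huge image.  The sum \<open>a\<close> of these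
  humps exists in \<open>A\<close>, and compressing \<open>\<phi> a\<close> recovers each huge image, so the norm of \<open>\<phi> a\<close>
  would exceed every bound.  Hence repeated splitting of a nonzero compression of \<open>s\<close> has to stop
  (\<open>orthogonal_splitting_terminates\<close>), at some \<open>t = q s p \<noteq> 0\<close> that no projection of any \<open>D\<^sub>k\<close> can split:
  \<open>d t\<close> and \<open>t d\<close> are always \<open>0\<close> or \<open>t\<close>.

  The second is that such an atom lives in a one-dimensional corner
  (\<open>atom_corner_one_dimensional\<close>).  Approximate \<open>t\<close> by some \<open>e\<close> in a finite stage \<open>C\<^sub>l\<close>, and let \<open>q\<close> and
  \<open>r\<close> be the minimal projections of \<open>D\<^sub>l\<close> supporting \<open>t\<close>; one may take \<open>e = q e r\<close>, and then \<open>e\<^sup>* e\<close> is a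
  multiple of \<open>r\<close>.  A projection \<open>0 \<noteq> d \<le> r\<close> of a later \<open>D\<^sub>j\<close> with \<open>t d = 0\<close> would give
  \<open>norm e = norm (e d) \<le> norm (t - e)\<close>, which is too small.  So \<open>r\<close>, and with it the whole
  corner, never splits.  As \<open>D\<^sub>j\<close> is a masa in \<open>C\<^sub>j\<close>, minimality of \<open>r\<close> in \<open>D\<^sub>j\<close> means that the corner
  \<open>r C\<^sub>j r\<close> consists of the multiples of \<open>r\<close>, and in the limit \<open>q C r\<close> is the line spanned by \<open>t\<close>.

  On a line every linear map is continuous, so compressing \<open>x\<^sub>n \<longlonglongrightarrow> 0\<close>, \<open>\<phi> x\<^sub>n \<longlonglongrightarrow> t\<close> to this corner yields
  \<open>t = 0\<close> (\<open>separating_space_no_one_dimensional_corner\<close>).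
\<close>

section \<open>Separating spaces and the closed graph theorem\<close>

definition separating_space :: "('a::real_normed_vector \<Rightarrow> 'b::real_normed_vector) \<Rightarrow> 'a set \<Rightarrow> 'b set"
  where "separating_space f A =
    {s. \<exists>x. (\<forall>n. x n \<in> A) \<and> x \<longlonglongrightarrow> 0 \<and> (\<lambda>n. f (x n)) \<longlonglongrightarrow> s}"

lemma separating_spaceI:
  assumes "\<And>n. x n \<in> A" "x \<longlonglongrightarrow> 0" "(\<lambda>n. f (x n)) \<longlonglongrightarrow> s"
  shows "s \<in> separating_space f A"
  using assms unfolding separating_space_def by blast

lemma separating_spaceE:
  assumes "s \<in> separating_space f A"
  obtains x where "\<And>n. x n \<in> A" "x \<longlonglongrightarrow> 0" "(\<lambda>n. f (x n)) \<longlonglongrightarrow> s"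
  using assms unfolding separating_space_def by blast

text \<open>
  This is where completeness of the domain enters: by Baire, one of the sets \<open>{x \<in> A. norm (f x) \<le> n}\<close>
  is dense in a ball.  Every vector is then approximated, up to half its norm, by vectors with an
  image of controlled size; the bound on \<open>f\<close> itself comes from iterating this.
\<close>

lemma dense_bounded_part_of_linear_map:
  fixes f :: "'a::banach \<Rightarrow> 'b::real_normed_vector"
  assumes "closed A" and "subspace A"
    and diff: "\<And>x y. x \<in> A \<Longrightarrow> y \<in> A \<Longrightarrow> f (x - y) = f x - f y"
    and scale: "\<And>c x. x \<in> A \<Longrightarrow> f (c *\<^sub>R x) = c *\<^sub>R f x"
  obtains K where "K \<ge> 0"
    and "\<And>y. y \<in> A \<Longrightarrow> \<exists>x\<in>A. norm (y - x) \<le> norm y / 2 \<and> norm (f x) \<le> K * norm y"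
proof -
  define F where "F n = {x\<in>A. norm (f x) \<le> real n}" for n :: nat
  let ?X = "top_of_set A"
  have F_sub: "F n \<subseteq> A" for n
    by (auto simp: F_def)
  have cl_sub: "closure (F n) \<subseteq> A" for n
    using F_sub \<open>closed A\<close> by (rule closure_minimal)
  have "A \<subseteq> (\<Union>n. closure (F n))"
  proof
    fix x assume "x \<in> A"
    then have "x \<in> F (nat \<lceil>norm (f x)\<rceil>)"
      by (simp add: F_def)
    then show "x \<in> (\<Union>n. closure (F n))"
      using closure_subset by blast
  qed
  with cl_sub have "(\<Union>n. closure (F n)) = A"
    by blast
  moreover have "0 \<in> A"
    using \<open>subspace A\<close> by (rule subspace_0)
  ultimately have "?X interior_of (\<Union>n. closure (F n)) \<noteq> {}"
    by (metis empty_iff interior_of_topspace topspace_euclidean_subtopology)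
  moreover have "completely_metrizable_space ?X"
    using \<open>closed A\<close> closed_closedin completely_metrizable_space_closedin
      completely_metrizable_space_euclidean by blast
  moreover have "closedin ?X (closure (F n))" for n
    using cl_sub by (simp add: closed_subset)
  ultimately obtain n where "?X interior_of (closure (F n)) \<noteq> {}"
    using Baire_category_alt[of ?X "range (\<lambda>n. closure (F n))"] by fastforce
  then obtain a where "a \<in> ?X interior_of (closure (F n))"
    by blast
  then obtain T where T: "openin ?X T" "a \<in> T" "T \<subseteq> closure (F n)"
    unfolding interior_of_def by blast
  then obtain e where "e > 0" and e: "\<And>x. x \<in> A \<Longrightarrow> dist x a < e \<Longrightarrow> x \<in> closure (F n)"
    unfolding openin_euclidean_subtopology_iff by (meson subsetD)
  have "a \<in> A"
    using T openin_subset by fastforce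
  \<comment> \<open>Differences of the two nearby points \<open>a\<close> and \<open>a + z\<close> move the ball to the origin.\<close>
  have near: "\<exists>x\<in>A. norm (z - x) < d \<and> norm (f x) \<le> 2 * real n"
    if "z \<in> A" "norm z < e" "d > 0" for z d
  proof -
    have "a \<in> closure (F n)"
      using e[OF \<open>a \<in> A\<close>] \<open>e > 0\<close> by simp
    then obtain u where u: "u \<in> F n" "dist u a < d / 2"
      using \<open>d > 0\<close> unfolding closure_approachable by (meson half_gt_zero)
    have "a + z \<in> closure (F n)"
      using e[of "a + z"] \<open>subspace A\<close> \<open>a \<in> A\<close> that by (simp add: subspace_add dist_norm)
    then obtain v where v: "v \<in> F n" "dist v (a + z) < d / 2"
      using \<open>d > 0\<close> unfolding closure_approachable by (meson half_gt_zero)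
    have "norm (z - (v - u)) \<le> dist u a + dist v (a + z)"
      using norm_triangle_ineq[of "u - a" "(a + z) - v"]
      by (simp add: dist_norm norm_minus_commute algebra_simps)
    moreover have "norm (f (v - u)) \<le> 2 * real n"
      using u v norm_triangle_ineq4[of "f v" "f u"] by (auto simp: F_def diff)
    moreover have "v - u \<in> A"
      using u v F_sub \<open>subspace A\<close> by (meson subsetD subspace_diff)
    ultimately show ?thesis
      using u v by force
  qed
  show thesis
  proof (rule that[of "4 * real n / e"])
    show "4 * real n / e \<ge> 0"
      using \<open>e > 0\<close> by simp
    fix y assume "y \<in> A"
    show "\<exists>x\<in>A. norm (y - x) \<le> norm y / 2 \<and> norm (f x) \<le> 4 * real n / e * norm y"
    proof (cases "y = 0")
      case True
      then show ?thesis
        using \<open>0 \<in> A\<close> scale[of 0 0] by auto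
    next
      case False
      define c where "c = e / (2 * norm y)"
      have "c > 0" "norm (c *\<^sub>R y) = e / 2"
        using False \<open>e > 0\<close> by (simp_all add: c_def)
      then obtain x where x: "x \<in> A" "norm (c *\<^sub>R y - x) < e / 4" "norm (f x) \<le> 2 * real n"
        using near[of "c *\<^sub>R y" "e / 4"] \<open>y \<in> A\<close> \<open>subspace A\<close> \<open>e > 0\<close> by (auto simp: subspace_scale)
      have "y - x /\<^sub>R c = (c *\<^sub>R y - x) /\<^sub>R c"
        using \<open>c > 0\<close> by (simp add: algebra_simps)
      then have "norm (y - x /\<^sub>R c) = norm (c *\<^sub>R y - x) / c"
        using \<open>c > 0\<close> by (simp add: divide_inverse mult.commute)
      also have "\<dots> \<le> (e / 4) / c"
        using x \<open>c > 0\<close> by (intro divide_right_mono) auto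
      also have "\<dots> = norm y / 2"
        using False \<open>e > 0\<close> by (simp add: c_def)
      finally have "norm (y - x /\<^sub>R c) \<le> norm y / 2" .
      moreover have "norm (f (x /\<^sub>R c)) = norm (f x) / c"
        using \<open>c > 0\<close> scale[OF x(1), of "inverse c"] by (simp add: divide_inverse mult.commute)
      moreover have "norm (f x) / c \<le> 2 * real n / c"
        using x \<open>c > 0\<close> by (intro divide_right_mono) auto
      moreover have "2 * real n / c = 4 * real n / e * norm y"
        using False \<open>e > 0\<close> by (simp add: c_def)
      moreover have "x /\<^sub>R c \<in> A"
        using x \<open>subspace A\<close> by (simp add: subspace_scale)
      ultimately show ?thesis
        by (metis (no_types))
    qed
  qed
qed

text \<open>
  Approximating a vector, then the remainder, and so on, writes \<open>y\<close> as a series whose image series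
  converges absolutely.  The remainders tend to \<open>0\<close>, so the difference between \<open>f y\<close> and the sum of
  the image series lies in the separating space, and \<open>f y\<close> inherits the bound of the series.
\<close>

lemma closed_graph_separating_space:
  fixes f :: "'a::banach \<Rightarrow> 'b::banach"
  assumes "closed A" and "subspace A"
    and diff: "\<And>x y. x \<in> A \<Longrightarrow> y \<in> A \<Longrightarrow> f (x - y) = f x - f y"
    and scale: "\<And>c x. x \<in> A \<Longrightarrow> f (c *\<^sub>R x) = c *\<^sub>R f x"
    and sep: "separating_space f A \<subseteq> {0}"
  shows "continuous_on A f"
proof -
  obtain K where "K \<ge> 0"
    and "\<And>y. y \<in> A \<Longrightarrow> \<exists>x\<in>A. norm (y - x) \<le> norm y / 2 \<and> norm (f x) \<le> K * norm y"
    using dense_bounded_part_of_linear_map[OF assms(1,2) diff scale] by metis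
  then obtain g where g: "\<And>y. y \<in> A \<Longrightarrow> g y \<in> A"
      "\<And>y. y \<in> A \<Longrightarrow> norm (y - g y) \<le> norm y / 2" "\<And>y. y \<in> A \<Longrightarrow> norm (f (g y)) \<le> K * norm y"
    by metis
  have bound: "norm (f y) \<le> 2 * K * norm y" if "y \<in> A" for y
  proof -
    \<comment> \<open>Successive remainders: each step removes an approximant of controlled image.\<close>
    define z where "z k = ((\<lambda>y. y - g y) ^^ k) y" for k
    have z_Suc: "z (Suc k) = z k - g (z k)" for k
      by (simp add: z_def)
    have zA: "z k \<in> A" for k
      by (induction k) (simp_all add: z_Suc \<open>y \<in> A\<close> g \<open>subspace A\<close> subspace_diff, simp add: z_def \<open>y \<in> A\<close>)
    have z_norm: "norm (z k) \<le> norm y * (1/2) ^ k" for k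
    proof (induction k)
      case 0
      show ?case by (simp add: z_def)
    next
      case (Suc k)
      then show ?case
        using g(2)[OF zA[of k]] by (simp add: z_Suc)
    qed
    have geo: "(\<lambda>k. K * norm y * (1/2) ^ k) sums (2 * K * norm y)"
      using sums_mult[OF geometric_sums[of "1/2::real"], of "K * norm y"] by (simp add: ac_simps)
    have fg: "norm (f (g (z k))) \<le> K * norm y * (1/2) ^ k" for k
      using g(3)[OF zA[of k]] mult_left_mono[OF z_norm[of k] \<open>K \<ge> 0\<close>] by (simp add: mult.assoc)
    have summ: "summable (\<lambda>k. f (g (z k)))"
      by (rule summable_comparison_test'[OF sums_summable[OF geo], of 0]) (rule fg)
    have "f (g (z k)) = f (z k) - f (z (Suc k))" for k
      using diff[OF zA[of k], of "g (z k)"] diff[OF zA[of k] zA[of "Suc k"]] by (simp add: z_Suc)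
    then have part: "(\<Sum>k<m. f (g (z k))) = f y - f (z m)" for m
      using sum_lessThan_telescope'[of "\<lambda>k. f (z k)" m] by (simp add: z_def)
    have "(\<lambda>m. f y - f (z m)) \<longlonglongrightarrow> (\<Sum>k. f (g (z k)))"
      using summable_LIMSEQ[OF summ] by (simp add: part)
    then have "(\<lambda>m. f (z m)) \<longlonglongrightarrow> f y - (\<Sum>k. f (g (z k)))"
      using tendsto_diff[OF tendsto_const[of "f y"]] by fastforce
    moreover have "z \<longlonglongrightarrow> 0"
    proof (rule Lim_null_comparison)
      show "\<forall>\<^sub>F k in sequentially. norm (z k) \<le> norm y * (1/2) ^ k"
        using z_norm by simp
      show "(\<lambda>k. norm y * (1/2) ^ k) \<longlonglongrightarrow> 0"
        using tendsto_mult_right_zero[OF LIMSEQ_power_zero[of "1/2::real"]] by simp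
    qed
    ultimately have "f y - (\<Sum>k. f (g (z k))) \<in> separating_space f A"
      unfolding separating_space_def using zA by blast
    then have "f y = (\<Sum>k. f (g (z k)))"
      using sep by auto
    also have "norm \<dots> \<le> 2 * K * norm y"
      using norm_suminf_le[OF fg sums_summable[OF geo]] sums_unique[OF geo] by simp
    finally show ?thesis .
  qed
  have "(2 * K)-lipschitz_on A f"
  proof (rule lipschitz_onI)
    fix x y assume "x \<in> A" "y \<in> A"
    then have "norm (f (x - y)) \<le> 2 * K * norm (x - y)"
      using \<open>subspace A\<close> by (intro bound) (rule subspace_diff)
    then show "dist (f x) (f y) \<le> 2 * K * dist x y"
      using diff \<open>x \<in> A\<close> \<open>y \<in> A\<close> by (simp add: dist_norm)
  qed (use \<open>K \<ge> 0\<close> in simp)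
  then show ?thesis
    by (rule lipschitz_on_continuous_on)
qed

section \<open>Projections and algebraic isomorphisms\<close>

definition projection :: "'a::cstar_algebra \<Rightarrow> bool" where
  "projection p \<longleftrightarrow> p * p = p \<and> star p = p"

lemma star_zero [simp]: "star (0 :: 'a::cstar_algebra) = 0"
  using star_scaleC[of 0 "0 :: 'a"] by simp

lemma star_minus: "star (- x) = - star (x :: 'a::cstar_algebra)"
  by (metis add.right_inverse add_eq_0_iff star_add star_zero)

lemma star_diff: "star (x - y) = star x - star (y :: 'a::cstar_algebra)"
  by (metis diff_conv_add_uminus star_add star_minus)

lemma star_eq_0_iff [simp]: "star x = 0 \<longleftrightarrow> x = (0 :: 'a::cstar_algebra)"
  by (metis star_star star_zero)

lemma star_mult_self_eq_0_iff [simp]: "star x * x = 0 \<longleftrightarrow> x = (0 :: 'a::cstar_algebra)"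
  by (metis cstar_identity norm_eq_zero power_zero_numeral zero_eq_power2 mult_zero_right)

lemma star_sum: "star (sum f P) = (\<Sum>x\<in>P. star (f x :: 'a::cstar_algebra))"
  by (induction P rule: infinite_finite_induct) (simp_all add: star_add)

lemma norm_projection:
  assumes "projection p" and "p \<noteq> 0"
  shows "norm p = 1"
  using assms cstar_identity[of p] by (simp add: projection_def power2_eq_square)

lemma norm_projection_le:
  assumes "projection p"
  shows "norm p \<le> 1"
  using assms norm_projection by force

lemma norm_compress_le:
  assumes "projection q" and "projection p"
  shows "norm (q * x * p) \<le> norm x"
proof -
  have "norm (q * x * p) \<le> norm q * norm x * norm p"
    by (meson norm_ge_zero norm_mult_ineq order_trans mult_right_mono)
  also have "\<dots> \<le> 1 * norm x * 1"
    using assms by (intro mult_mono norm_projection_le) auto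
  finally show ?thesis by simp
qed

lemma norm_mult_projection_le:
  assumes "projection p"
  shows "norm (x * p) \<le> norm x"
proof -
  have "norm (x * p) \<le> norm x * 1"
    by (meson norm_mult_ineq order_trans mult_left_mono norm_projection_le[OF assms] norm_ge_zero)
  then show ?thesis by simp
qed

lemma complex_subalgebraD:
  assumes "complex_subalgebra A"
  shows "0 \<in> A" and "x \<in> A \<Longrightarrow> y \<in> A \<Longrightarrow> x + y \<in> A" and "x \<in> A \<Longrightarrow> y \<in> A \<Longrightarrow> x - y \<in> A"
    and "x \<in> A \<Longrightarrow> c *\<^sub>C x \<in> A" and "x \<in> A \<Longrightarrow> y \<in> A \<Longrightarrow> x * y \<in> A"
  using assms
  by (auto simp: complex_subalgebra_def complex_vector.subspace_0 complex_vector.subspace_add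
      complex_vector.subspace_diff complex_vector.subspace_scale)

lemma complex_subalgebra_real_subspace:
  assumes "complex_subalgebra A"
  shows "subspace A"
  unfolding subspace_def using complex_subalgebraD[OF assms] by (metis scaleC_of_real)

lemma algebraic_isomorphismD:
  assumes "algebraic_isomorphism \<phi> A B"
  shows "bij_betw \<phi> A B" and "inj_on \<phi> A" and "\<And>x. x \<in> A \<Longrightarrow> \<phi> x \<in> B"
    and "\<And>b. b \<in> B \<Longrightarrow> \<exists>a\<in>A. \<phi> a = b"
    and "\<And>x y. x \<in> A \<Longrightarrow> y \<in> A \<Longrightarrow> \<phi> (x + y) = \<phi> x + \<phi> y"
    and "\<And>x y. x \<in> A \<Longrightarrow> y \<in> A \<Longrightarrow> \<phi> (x * y) = \<phi> x * \<phi> y"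
    and "\<And>c x. x \<in> A \<Longrightarrow> \<phi> (c *\<^sub>C x) = c *\<^sub>C \<phi> x"
    and "\<And>c x. x \<in> A \<Longrightarrow> \<phi> (c *\<^sub>R x) = c *\<^sub>R \<phi> x"
proof -
  show b: "bij_betw \<phi> A B" and c: "\<And>c x. x \<in> A \<Longrightarrow> \<phi> (c *\<^sub>C x) = c *\<^sub>C \<phi> x"
    and "\<And>x y. x \<in> A \<Longrightarrow> y \<in> A \<Longrightarrow> \<phi> (x + y) = \<phi> x + \<phi> y"
    and "\<And>x y. x \<in> A \<Longrightarrow> y \<in> A \<Longrightarrow> \<phi> (x * y) = \<phi> x * \<phi> y"
    using assms by (auto simp: algebraic_isomorphism_def)
  show "inj_on \<phi> A" and "\<And>x. x \<in> A \<Longrightarrow> \<phi> x \<in> B" and "\<And>b. b \<in> B \<Longrightarrow> \<exists>a\<in>A. \<phi> a = b"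
    using b by (auto simp: bij_betw_def)
  show "\<And>c x. x \<in> A \<Longrightarrow> \<phi> (c *\<^sub>R x) = c *\<^sub>R \<phi> x"
    using c scaleC_of_real by metis
qed

lemma algebraic_isomorphism_zero:
  assumes "complex_subalgebra A" and "algebraic_isomorphism \<phi> A B"
  shows "\<phi> 0 = 0"
  using algebraic_isomorphismD(7)[OF assms(2) complex_subalgebraD(1)[OF assms(1)], of 0] by simp

lemma algebraic_isomorphism_diff:
  assumes "complex_subalgebra A" and "algebraic_isomorphism \<phi> A B" and "x \<in> A" and "y \<in> A"
  shows "\<phi> (x - y) = \<phi> x - \<phi> y"
  using algebraic_isomorphismD(5)[OF assms(2) complex_subalgebraD(3)[OF assms(1,3,4)] assms(4)]
  by simp

lemma algebraic_isomorphism_eq_0_iff: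
  assumes "complex_subalgebra A" and "algebraic_isomorphism \<phi> A B" and "x \<in> A"
  shows "\<phi> x = 0 \<longleftrightarrow> x = 0"
  using algebraic_isomorphism_zero[OF assms(1,2)] algebraic_isomorphismD(2)[OF assms(2)]
    complex_subalgebraD(1)[OF assms(1)] assms(3) by (metis inj_onD)

section \<open>The gliding hump\<close>

lemma separating_space_compress:
  fixes \<phi> :: "'a::cstar_algebra \<Rightarrow> 'b::cstar_algebra"
  assumes A: "complex_subalgebra A" and iso: "algebraic_isomorphism \<phi> A B"
    and "s \<in> separating_space \<phi> A" and "q \<in> B" and "p \<in> B"
  shows "q * s * p \<in> separating_space \<phi> A"
proof -
  obtain x where x: "\<And>n. x n \<in> A" "x \<longlonglongrightarrow> 0" "(\<lambda>n. \<phi> (x n)) \<longlonglongrightarrow> s"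
    using assms(3) by (rule separating_spaceE) blast
  obtain f g where fg: "f \<in> A" "\<phi> f = q" "g \<in> A" "\<phi> g = p"
    using algebraic_isomorphismD(4)[OF iso] assms(4,5) by metis
  have "\<phi> (f * x n * g) = q * \<phi> (x n) * p" for n
    using fg x(1) by (simp add: algebraic_isomorphismD(6)[OF iso] complex_subalgebraD(5)[OF A])
  moreover have "(\<lambda>n. q * \<phi> (x n) * p) \<longlonglongrightarrow> q * s * p"
    by (intro tendsto_intros x)
  moreover have "(\<lambda>n. f * x n * g) \<longlonglongrightarrow> 0"
    using tendsto_mult[OF tendsto_mult[OF tendsto_const[of f] x(2)] tendsto_const[of g]] by simp
  ultimately show ?thesis
    using fg x(1) by (intro separating_spaceI[of "\<lambda>n. f * x n * g"]) (simp_all add: complex_subalgebraD(5)[OF A])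
qed

text \<open>
  Compressing a null sequence whose images tend to \<open>s\<close> gives elements of the corner \<open>f A g\<close> that tend
  to \<open>0\<close> while their images stay away from \<open>0\<close>; rescaling makes the ratio as large as desired.
  Smallness is required of \<open>f x g\<close> rather than of \<open>x\<close>, because the idempotents \<open>f\<close> and \<open>g\<close> may have
  large norm.
\<close>

lemma separating_space_hump:
  fixes \<phi> :: "'a::cstar_algebra \<Rightarrow> 'b::cstar_algebra"
  assumes A: "complex_subalgebra A" and iso: "algebraic_isomorphism \<phi> A B"
    and s: "s \<in> separating_space \<phi> A" and fg: "f \<in> A" "g \<in> A" and nz: "\<phi> f * s * \<phi> g \<noteq> 0"
    and "e > 0" and "K \<ge> 0"
  obtains x where "x \<in> A" and "norm (f * x * g) \<le> e" and "norm (\<phi> (f * x * g)) \<ge> K"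
proof -
  obtain x where x: "\<And>n. x n \<in> A" "x \<longlonglongrightarrow> 0" "(\<lambda>n. \<phi> (x n)) \<longlonglongrightarrow> s"
    using s by (rule separating_spaceE) blast
  define t where "t = \<phi> f * s * \<phi> g"
  define c where "c = 2 * K / norm t"
  have "t \<noteq> 0" "c \<ge> 0"
    using nz \<open>K \<ge> 0\<close> by (simp_all add: c_def t_def)
  have \<phi>: "\<phi> (f * (c *\<^sub>R x n) * g) = c *\<^sub>R (\<phi> f * \<phi> (x n) * \<phi> g)" for n
    using fg x(1) algebraic_isomorphismD(8)[OF iso, of "f * x n * g"]
    by (simp add: algebraic_isomorphismD(6)[OF iso] complex_subalgebraD(5)[OF A])
  have "(\<lambda>n. f * (c *\<^sub>R x n) * g) \<longlonglongrightarrow> f * (c *\<^sub>R 0) * g"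
    by (intro tendsto_intros x)
  then have "(\<lambda>n. f * (c *\<^sub>R x n) * g) \<longlonglongrightarrow> 0"
    by simp
  then have "(\<lambda>n. norm (f * (c *\<^sub>R x n) * g)) \<longlonglongrightarrow> 0"
    by (rule tendsto_norm_zero)
  then have "\<forall>\<^sub>F n in sequentially. norm (f * (c *\<^sub>R x n) * g) < e"
    using \<open>e > 0\<close> by (rule order_tendstoD)
  moreover have "(\<lambda>n. norm (\<phi> f * \<phi> (x n) * \<phi> g)) \<longlonglongrightarrow> norm t"
    unfolding t_def by (intro tendsto_intros x)
  then have "\<forall>\<^sub>F n in sequentially. norm t / 2 < norm (\<phi> f * \<phi> (x n) * \<phi> g)"
    by (rule order_tendstoD) (use \<open>t \<noteq> 0\<close> in simp)
  ultimately have "\<forall>\<^sub>F n in sequentially. norm (f * (c *\<^sub>R x n) * g) < e \<and>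
      norm t / 2 < norm (\<phi> f * \<phi> (x n) * \<phi> g)"
    by (rule eventually_conj)
  then obtain n where n: "norm (f * (c *\<^sub>R x n) * g) < e"
      "norm t / 2 < norm (\<phi> f * \<phi> (x n) * \<phi> g)"
    using eventually_happens'[OF sequentially_bot] by blast
  have "K = c * (norm t / 2)"
    using \<open>t \<noteq> 0\<close> by (simp add: c_def)
  also have "\<dots> \<le> c * norm (\<phi> f * \<phi> (x n) * \<phi> g)"
    using n \<open>c \<ge> 0\<close> by (intro mult_left_mono) auto
  also have "\<dots> = norm (\<phi> (f * (c *\<^sub>R x n) * g))"
    using \<open>c \<ge> 0\<close> \<phi> by simp
  finally show thesis
    using n x(1) complex_subalgebra_real_subspace[OF A]
    by (intro that[of "c *\<^sub>R x n"]) (auto simp: subspace_scale)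
qed

text \<open>
  The homomorphism property is what makes the argument work: compression by \<open>q n\<close> and \<open>p n\<close> after \<open>\<phi>\<close>
  is compression by their preimages before \<open>\<phi>\<close>, and the latter isolates a single hump of the series.
  Orthogonality on one side is enough for this.
\<close>

lemma gliding_hump:
  fixes \<phi> :: "'a::cstar_algebra \<Rightarrow> 'b::cstar_algebra"
  assumes A: "complex_subalgebra A" and "closed A" and iso: "algebraic_isomorphism \<phi> A B"
    and s: "s \<in> separating_space \<phi> A"
    and q: "\<And>n. q n \<in> B" "\<And>n. projection (q n)"
    and p: "\<And>n. p n \<in> B" "\<And>n. projection (p n)"
    and orth: "\<And>m n. m \<noteq> n \<Longrightarrow> q m * q n = 0 \<or> p m * p n = 0"
  shows "\<exists>n::nat. q n * s * p n = 0"
proof (rule ccontr)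
  assume "\<nexists>n. q n * s * p n = 0"
  then have nz: "q n * s * p n \<noteq> 0" for n
    by blast
  note hom = algebraic_isomorphismD(6)[OF iso] and mem = complex_subalgebraD(5)[OF A]
  obtain f where f: "\<And>n. f n \<in> A" "\<And>n. \<phi> (f n) = q n"
    using algebraic_isomorphismD(4)[OF iso q(1)] by metis
  obtain g where g: "\<And>n. g n \<in> A" "\<And>n. \<phi> (g n) = p n"
    using algebraic_isomorphismD(4)[OF iso p(1)] by metis
  have "\<phi> (f n * f n) = \<phi> (f n)" "\<phi> (g n * g n) = \<phi> (g n)" for n
    using f g q(2)[of n] p(2)[of n] by (simp_all add: hom projection_def)
  then have idem: "f n * f n = f n" "g n * g n = g n" for n
    by (auto intro!: inj_onD[OF algebraic_isomorphismD(2)[OF iso]] mem f g)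
  have orth': "f n * f m = 0 \<or> g m * g n = 0" if "m \<noteq> n" for m n
  proof -
    have "q n * q m = 0 \<or> p m * p n = 0"
    proof -
      have "q n * q m = star (q m * q n)"
        using q(2) by (simp add: star_mult projection_def)
      then show ?thesis
        using orth[OF that] by auto
    qed
    then have "\<phi> (f n * f m) = 0 \<or> \<phi> (g m * g n) = 0"
      using f g by (simp add: hom)
    then show ?thesis
      using algebraic_isomorphism_eq_0_iff[OF A iso] mem f g by blast
  qed
  have "\<exists>x. x \<in> A \<and> norm (f n * x * g n) \<le> (1/2) ^ n \<and> norm (\<phi> (f n * x * g n)) \<ge> real n" for n
    using separating_space_hump[OF A iso s f(1) g(1), of n n "(1/2) ^ n" "real n"] nz f g
    by (metis of_nat_0_le_iff half_gt_zero_iff zero_less_one zero_less_power)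
  then obtain x where x: "\<And>n. x n \<in> A" "\<And>n. norm (f n * x n * g n) \<le> (1/2) ^ n"
      "\<And>n. norm (\<phi> (f n * x n * g n)) \<ge> real n"
    by metis
  define b where "b n = f n * x n * g n" for n
  define a where "a = (\<Sum>n. b n)"
  have bA: "b n \<in> A" for n
    by (simp add: b_def mem f g x)
  have "summable b"
  proof (rule summable_comparison_test')
    show "summable (\<lambda>n. (1/2::real) ^ n)"
      by (rule summable_geometric) simp
    show "norm (b n) \<le> (1/2) ^ n" if "0 \<le> n" for n
      unfolding b_def by (rule x(2))
  qed
  then have b_sums: "b sums a"
    by (simp add: a_def summable_sums)
  have "a \<in> A"
  proof (rule closed_sequentially[OF \<open>closed A\<close>])
    show "(\<lambda>n. \<Sum>i<n. b i) \<longlonglongrightarrow> a"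
      using b_sums by (simp add: sums_def)
    show "(\<Sum>i<n. b i) \<in> A" for n
      using bA by (auto intro!: subspace_sum complex_subalgebra_real_subspace A)
  qed
  have cut: "f n * b m * g n = (if m = n then b n else 0)" for m n
  proof -
    have "f n * b m * g n = (f n * f m) * x m * (g m * g n)"
      by (simp add: b_def mult.assoc)
    then show ?thesis
      using orth'[of m n] idem[of n] by (auto simp: b_def)
  qed
  have "f n * a * g n = b n" for n
  proof (rule sums_unique2)
    show "(\<lambda>m. f n * b m * g n) sums (f n * a * g n)"
      by (intro sums_mult sums_mult2 b_sums)
    show "(\<lambda>m. f n * b m * g n) sums b n"
      unfolding cut using sums_single[of n "\<lambda>_. b n"] by simp
  qed
  then have "\<phi> (b n) = q n * \<phi> a * p n" for n
    using f g \<open>a \<in> A\<close> by (metis hom mem)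
  then have "real n \<le> norm (\<phi> a)" for n
    using x(3)[of n] norm_compress_le[OF q(2) p(2), of n "\<phi> a" n] by (simp add: b_def)
  then show False
    using reals_Archimedean2[of "norm (\<phi> a)"] by (meson not_le)
qed

text \<open>
  If every nonzero compression could be split by some element of \<open>Q\<close>, then starting from \<open>q0\<close>, \<open>p0\<close> and
  splitting one half again and again, the halves left behind would form an infinite sequence of
  pairwise orthogonal pairs, as excluded by \<open>finite_hump\<close>.
\<close>

lemma orthogonal_splitting_terminates:
  fixes s :: "'a::cstar_algebra"
  assumes proj: "\<And>p. p \<in> Q \<Longrightarrow> projection p"
    and comm: "\<And>p d. p \<in> Q \<Longrightarrow> d \<in> Q \<Longrightarrow> p * d = d * p"
    and mult: "\<And>p d. p \<in> Q \<Longrightarrow> d \<in> Q \<Longrightarrow> p * d \<in> Q"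
    and diff: "\<And>p d. p \<in> Q \<Longrightarrow> d \<in> Q \<Longrightarrow> p - p * d \<in> Q"
    and start: "q0 \<in> Q" "p0 \<in> Q" "q0 * s * p0 \<noteq> 0"
    and finite_hump: "\<And>q p. (\<And>n. q n \<in> Q) \<Longrightarrow> (\<And>n. p n \<in> Q) \<Longrightarrow>
      (\<And>m n. m \<noteq> n \<Longrightarrow> q m * q n = 0 \<or> p m * p n = 0) \<Longrightarrow> \<exists>n::nat. q n * s * p n = 0"
  obtains q p where "q \<in> Q" "p \<in> Q" "q * s * p \<noteq> 0"
    and "\<forall>d\<in>Q. d * (q * s * p) = 0 \<or> d * (q * s * p) = q * s * p"
    and "\<forall>d\<in>Q. (q * s * p) * d = 0 \<or> (q * s * p) * d = q * s * p"
proof (rule ccontr)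
  assume no: "\<not> thesis"
  note atom = that
  define bad where "bad w \<longleftrightarrow> fst w \<in> Q \<and> snd w \<in> Q \<and> fst w * s * snd w \<noteq> 0" for w
  define below where "below v w \<longleftrightarrow> fst v * fst w = fst v \<and> snd v * snd w = snd v"
    for v w :: "'a \<times> 'a"
  define orth where "orth v w \<longleftrightarrow> fst v * fst w = 0 \<or> snd v * snd w = 0" for v w :: "'a \<times> 'a"
  note defs = bad_def below_def orth_def
  have idem: "p * p = p" if "p \<in> Q" for p
    using proj[OF that] by (simp add: projection_def)
  have split: "\<exists>v v'. bad v \<and> bad v' \<and> below v w \<and> below v' w \<and> orth v v'" if "bad w" for w
  proof -
    define q p where "q = fst w" and "p = snd w"
    have qp: "q \<in> Q" "p \<in> Q" "q * s * p \<noteq> 0"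
      using \<open>bad w\<close> by (simp_all add: defs q_def p_def)
    have "\<exists>d\<in>Q. (d * (q * s * p) \<noteq> 0 \<and> d * (q * s * p) \<noteq> q * s * p) \<or>
       ((q * s * p) * d \<noteq> 0 \<and> (q * s * p) * d \<noteq> q * s * p)"
    proof (rule ccontr)
      assume "\<not> ?thesis"
      then have thesis
        by (intro atom[OF qp]) blast+
      with no show False ..
    qed
    then obtain d where d: "d \<in> Q" and
      "(d * (q * s * p) \<noteq> 0 \<and> d * (q * s * p) \<noteq> q * s * p) \<or>
       ((q * s * p) * d \<noteq> 0 \<and> (q * s * p) * d \<noteq> q * s * p)"
      by blast
    then consider "d * (q * s * p) \<noteq> 0" "d * (q * s * p) \<noteq> q * s * p"
      | "(q * s * p) * d \<noteq> 0" "(q * s * p) * d \<noteq> q * s * p"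
      by blast
    then show ?thesis
    proof cases
      case 1
      have "d * q = q * d"
        using comm d qp by blast
      have "(q * d) * s * p \<noteq> 0" "(q - q * d) * s * p \<noteq> 0"
        using 1 by (simp_all add: \<open>d * q = q * d\<close>[symmetric] mult.assoc left_diff_distrib)
      moreover have "q * d * q = q * d" "(q - q * d) * q = q - q * d"
        using idem[OF qp(1)] by (simp_all add: algebra_simps \<open>d * q = q * d\<close>)
          (simp_all add: mult.assoc[symmetric])
      moreover have "(q * d) * (q - q * d) = 0"
        using idem[OF qp(1)] idem[OF d] \<open>q * d * q = q * d\<close> 
        by (simp add: right_diff_distrib mult.assoc[symmetric]) (simp add: mult.assoc)
      ultimately have "bad (q * d, p) \<and> bad (q - q * d, p) \<and> below (q * d, p) w \<and>
          below (q - q * d, p) w \<and> orth (q * d, p) (q - q * d, p)"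
        using qp d by (simp add: defs mult diff idem flip: q_def p_def)
      then show ?thesis by blast
    next
      case 2
      have "d * p = p * d"
        using comm d qp by blast
      have "q * s * (p * d) \<noteq> 0" "q * s * (p - p * d) \<noteq> 0"
        using 2 by (simp_all add: mult.assoc right_diff_distrib)
      moreover have "p * d * p = p * d" "(p - p * d) * p = p - p * d"
        using idem[OF qp(2)] by (simp_all add: algebra_simps \<open>d * p = p * d\<close>)
          (simp_all add: mult.assoc[symmetric])
      moreover have "(p * d) * (p - p * d) = 0"
        using idem[OF qp(2)] idem[OF d] \<open>p * d * p = p * d\<close>
        by (simp add: right_diff_distrib mult.assoc[symmetric]) (simp add: mult.assoc)
      ultimately have "bad (q, p * d) \<and> bad (q, p - p * d) \<and> below (q, p * d) w \<and>
          below (q, p - p * d) w \<and> orth (q, p * d) (q, p - p * d)"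
        using qp d by (simp add: defs mult diff idem flip: q_def p_def)
      then show ?thesis by blast
    qed
  qed
  then obtain F G where FG: "\<And>w. bad w \<Longrightarrow> bad (F w) \<and> bad (G w) \<and> below (F w) w \<and>
      below (G w) w \<and> orth (F w) (G w)"
    by metis
  \<comment> \<open>\<open>W n\<close> is the half split further at stage \<open>n\<close>, and \<open>G (W n)\<close> the half left behind.\<close>
  define W where "W n = (F ^^ n) (q0, p0)" for n
  have W_Suc: "W (Suc n) = F (W n)" for n
    by (simp add: W_def)
  have bad_W: "bad (W n)" for n
    by (induction n) (use start FG in \<open>auto simp: W_Suc\<close>, simp add: W_def defs)
  have below_trans: "below u w" if "below u v" "below v w" for u v w
    using that unfolding below_def by (metis mult.assoc)
  have below_W: "below (W m) (W n)" if "n \<le> m" for m n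
    using that
  proof (induction m rule: dec_induct)
    case base
    show ?case using bad_W[of n] idem by (simp add: defs)
  next
    case (step m)
    then show ?case using FG[OF bad_W[of m]] below_trans by (metis W_Suc)
  qed
  have orth_lt: "orth (G (W m)) (G (W n))" if "n < m" for m n
  proof -
    have "below (G (W m)) (F (W n))"
      using below_trans FG[OF bad_W[of m]] below_W[of "Suc n" m] that by (metis W_Suc Suc_leI)
    moreover have "orth (F (W n)) (G (W n))"
      using FG[OF bad_W[of n]] by blast
    moreover have "u * w = 0" if "u * v = u" "v * w = 0" for u v w :: 'a
      by (metis that mult.assoc mult_zero_right)
    ultimately show ?thesis
      unfolding below_def orth_def by blast
  qed
  have orth_ne: "orth (G (W m)) (G (W n))" if "m \<noteq> n" for m n
  proof (cases "n < m")
    case False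
    then have "orth (G (W n)) (G (W m))"
      using that by (intro orth_lt) simp
    moreover have "bad (G (W m))" "bad (G (W n))"
      using FG[OF bad_W] by blast+
    ultimately show ?thesis
      unfolding orth_def bad_def by (simp add: comm)
  qed (rule orth_lt)
  have "\<exists>n. fst (G (W n)) * s * snd (G (W n)) = 0"
    using FG[OF bad_W] orth_ne by (intro finite_hump) (auto simp: orth_def bad_def)
  then show False
    using FG[OF bad_W] by (auto simp: bad_def)
qed

section \<open>Joint eigenvectors in finite dimensional algebras\<close>

text \<open>
  This is \<open>P(x) v\<close>, written in Horner form because the algebra may have no unit, so that
  \<open>P(x)\<close> alone need not make sense.
\<close>

definition poly_act :: "complex poly \<Rightarrow> 'a::cstar_algebra \<Rightarrow> 'a \<Rightarrow> 'a" where
  "poly_act P x v = fold_coeffs (\<lambda>a w. a *\<^sub>C v + x * w) P 0"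

lemma poly_act_0 [simp]: "poly_act 0 x v = 0"
  by (simp add: poly_act_def)

lemma poly_act_pCons [simp]: "poly_act (pCons a P) x v = a *\<^sub>C v + x * poly_act P x v"
proof (cases "a = 0 \<and> P = 0")
  case False
  then have "pCons a P \<noteq> 0" by auto
  then show ?thesis by (simp add: poly_act_def cCons_def fold_coeffs_def)
qed auto

lemma poly_act_add: "poly_act (P + Q) x v = poly_act P x v + poly_act Q x v"
  by (induction P Q rule: poly_induct2) (simp_all add: scaleC_add_left distrib_left)

lemma poly_act_smult: "poly_act (smult c P) x v = c *\<^sub>C poly_act P x v"
  by (induction P) (simp_all add: scaleC_add_right scaleC_scaleC mult_scaleC_right)

lemma poly_act_monom: "poly_act (monom c n) x v = c *\<^sub>C ((*) x ^^ n) v"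
  by (induction n) (simp_all add: monom_0 monom_Suc mult_scaleC_right)

lemma poly_act_sum: "poly_act (sum f I) x v = (\<Sum>i\<in>I. poly_act (f i) x v)"
  by (induction I rule: infinite_finite_induct) (simp_all add: poly_act_add)

lemma poly_act_linear_factor:
  "poly_act ([:- l, 1:] * Q) x v = x * poly_act Q x v - l *\<^sub>C poly_act Q x v"
proof -
  have "[:- l, 1:] * Q = smult (- l) Q + pCons 0 Q"
    by simp
  then show ?thesis
    by (simp only: poly_act_add poly_act_smult poly_act_pCons) simp
qed

lemma poly_act_commuting_eigenvector:
  assumes "y * x = x * y" and "y * v = c *\<^sub>C v"
  shows "y * poly_act P x v = c *\<^sub>C poly_act P x v"
proof (induction P)
  case (pCons a P)
  have "y * (x * poly_act P x v) = x * (y * poly_act P x v)"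
    by (metis assms(1) mult.assoc)
  then show ?case
    using pCons assms(2) by (simp add: distrib_left mult_scaleC_right scaleC_add_right mult.commute scaleC_scaleC)
qed simp

lemma poly_act_mem:
  assumes "complex_subalgebra E" and "x \<in> E" and "v \<in> E"
  shows "poly_act P x v \<in> E"
  by (induction P) (simp_all add: complex_subalgebraD[OF assms(1)] assms(2,3))

lemma annihilating_poly_exists:
  assumes E: "complex_subalgebra E" and "finite_dimensional E" and "x \<in> E" and "v \<in> E"
  shows "\<exists>P. P \<noteq> 0 \<and> poly_act P x v = 0"
proof -
  obtain S where S: "finite S" "E \<subseteq> complex_vector.span S"
    using assms(2) by (auto simp: finite_dimensional_def)
  define w where "w i = ((*) x ^^ i) v" for i
  have w: "poly_act (monom c i) x v = c *\<^sub>C w i" for c i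
    by (simp add: poly_act_monom w_def)
  have wE: "w i \<in> E" for i
    using poly_act_mem[OF E assms(3,4), of "monom 1 i"] by (simp add: w)
  show ?thesis
  proof (cases "inj_on w {..card S}")
    case False
    then obtain i j where "i \<noteq> j" "w i = w j"
      by (auto simp: inj_on_def)
    then have "monom 1 i + monom (- 1) j \<noteq> (0 :: complex poly)"
      by (metis add.commute add_minus_cancel add.right_neutral minus_monom monom_eq_iff'
          one_neq_zero add_eq_0_iff minus_minus)
    moreover have "poly_act (monom 1 i + monom (- 1) j) x v = 0"
      using \<open>w i = w j\<close> by (simp add: poly_act_add w)
    ultimately show ?thesis by blast
  next
    case True
    have "\<not> complex_vector.independent (w ` {..card S})"
    proof
      assume "complex_vector.independent (w ` {..card S})"
      then have "card (w ` {..card S}) \<le> card S"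
        using complex_vector.independent_span_bound[OF S(1)] wE S(2) by blast
      then show False
        using card_image[OF True] by simp
    qed
    then obtain u where u: "\<exists>y\<in>w ` {..card S}. u y \<noteq> 0" "(\<Sum>y\<in>w ` {..card S}. u y *\<^sub>C y) = 0"
      using complex_vector.dependent_finite[of "w ` {..card S}"] by auto
    define P where "P = (\<Sum>i\<le>card S. monom (u (w i)) i)"
    have "coeff P i = u (w i)" if "i \<le> card S" for i
      using that by (simp add: P_def coeff_sum sum.delta)
    then have "P \<noteq> 0"
      using u(1) by auto
    moreover have "poly_act P x v = 0"
      using u(2) by (simp add: P_def poly_act_sum w sum.reindex[OF True])
    ultimately show ?thesis by blast
  qed
qed

text \<open>
  Among the nonzero polynomials that annihilate \<open>v\<close>, one of least degree has a root; removing the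
  corresponding linear factor leaves an eigenvector.  It is recorded as a polynomial in \<open>x\<close> applied to
  \<open>v\<close>, so that elements commuting with \<open>x\<close> for which \<open>v\<close> is an eigenvector keep this property.
\<close>

lemma eigenvector_exists:
  assumes E: "complex_subalgebra E" and "finite_dimensional E" and "x \<in> E" and "v \<in> E" and "v \<noteq> 0"
  shows "\<exists>Q l. poly_act Q x v \<noteq> 0 \<and> x * poly_act Q x v = l *\<^sub>C poly_act Q x v"
proof -
  obtain P where P: "P \<noteq> 0" "poly_act P x v = 0"
    and min: "\<And>Q. Q \<noteq> 0 \<and> poly_act Q x v = 0 \<Longrightarrow> degree P \<le> degree Q"
    using annihilating_poly_exists[OF assms(1-4)]
      ex_has_least_nat[of "\<lambda>P. P \<noteq> 0 \<and> poly_act P x v = 0" _ degree] by metis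
  have "degree P \<noteq> 0"
  proof
    assume "degree P = 0"
    then obtain a where "P = [:a:]"
      by (rule degree_eq_zeroE)
    then show False
      using P \<open>v \<noteq> 0\<close> by simp
  qed
  then have "\<not> constant (poly P)"
    by (simp add: constant_degree)
  then obtain l where "poly P l = 0"
    using fundamental_theorem_of_algebra by blast
  then obtain Q where Q: "P = [:- l, 1:] * Q"
    by (auto simp: poly_eq_0_iff_dvd)
  with P have "Q \<noteq> 0"
    by auto
  then have "degree P = Suc (degree Q)"
    using degree_mult_eq[of "[:- l, 1:]" Q] Q by simp
  then have "poly_act Q x v \<noteq> 0"
    using min[of Q] \<open>Q \<noteq> 0\<close> by auto
  moreover have "x * poly_act Q x v = l *\<^sub>C poly_act Q x v"
    using P(2) unfolding Q poly_act_linear_factor by simp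
  ultimately show ?thesis by blast
qed

text \<open>
  Treat the elements of a finite basis one after the other: by commutativity, the eigenvector found
  for the next one is still an eigenvector for those already treated.
\<close>

lemma joint_eigenvector_exists:
  assumes E: "complex_subalgebra E" and "finite_dimensional E" and "abelian E" and "v0 \<in> E" and "v0 \<noteq> 0"
  shows "\<exists>v\<in>E. v \<noteq> 0 \<and> (\<forall>x\<in>E. \<exists>c. x * v = c *\<^sub>C v)"
proof -
  obtain S where S: "finite S" "E \<subseteq> complex_vector.span S"
    using assms(2) by (auto simp: finite_dimensional_def)
  obtain F where F: "F \<subseteq> E" "complex_vector.independent F" "E \<subseteq> complex_vector.span F"
    by (rule complex_vector.maximal_independent_subset)
  have "finite F"
    using complex_vector.independent_span_bound[OF S(1) F(2)] F(1) S(2) by blast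
  then have "\<exists>v\<in>E. v \<noteq> 0 \<and> (\<forall>x\<in>F. \<exists>c. x * v = c *\<^sub>C v)"
    using F(1)
  proof (induction F)
    case empty
    show ?case using assms(4,5) by blast
  next
    case (insert y F)
    then obtain v where v: "v \<in> E" "v \<noteq> 0" "\<And>x. x \<in> F \<Longrightarrow> \<exists>c. x * v = c *\<^sub>C v"
      by auto
    obtain Q l where Q: "poly_act Q y v \<noteq> 0" "y * poly_act Q y v = l *\<^sub>C poly_act Q y v"
      using eigenvector_exists[OF E assms(2) _ v(1,2)] insert.prems by blast
    have "\<exists>c. x * poly_act Q y v = c *\<^sub>C poly_act Q y v" if "x \<in> F" for x
    proof -
      have "x * y = y * x"
        using that insert.prems \<open>abelian E\<close> by (auto simp: abelian_def)
      then show ?thesis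
        using v(3)[OF that] poly_act_commuting_eigenvector by metis
    qed
    moreover have "poly_act Q y v \<in> E"
      using poly_act_mem[OF E _ v(1)] insert.prems by blast
    ultimately show ?case
      using Q by blast
  qed
  then obtain v where v: "v \<in> E" "v \<noteq> 0" "\<And>x. x \<in> F \<Longrightarrow> \<exists>c. x * v = c *\<^sub>C v"
    by blast
  have "\<exists>c. x * v = c *\<^sub>C v" if "x \<in> complex_vector.span F" for x
    using that
  proof (induction rule: complex_vector.span_induct_alt)
    case base
    show ?case by (rule exI[of _ 0]) simp
  next
    case (step a x y)
    then show ?case
      using v(3)[OF step(1)] by (metis distrib_right mult_scaleC_left scaleC_scaleC scaleC_add_left)
  qed
  then show ?thesis
    using v(1,2) F(3) by blast
qed

section \<open>Minimal projections and masas\<close>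

definition minimal_projection :: "'a::cstar_algebra \<Rightarrow> 'a set \<Rightarrow> bool" where
  "minimal_projection r E \<longleftrightarrow> r \<in> E \<and> projection r \<and> r \<noteq> 0 \<and> (\<forall>x\<in>E. \<exists>c. x * r = c *\<^sub>C r)"

text \<open>
  A joint eigenvector \<open>v\<close> yields the selfadjoint joint eigenvector \<open>w = v\<^sup>* v\<close>.  Its square is a multiple of
  \<open>w\<close>, nonzero by the C*-identity, so a multiple of \<open>w\<close> is idempotent, and it spans an ideal.
\<close>

lemma minimal_projection_exists:
  assumes E: "star_subalgebra E" and "finite_dimensional E" and ab: "abelian E" and "v0 \<in> E" and "v0 \<noteq> 0"
  shows "\<exists>r. minimal_projection r E"
proof -
  have sub: "complex_subalgebra E" and star: "\<And>x. x \<in> E \<Longrightarrow> star x \<in> E"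
    using E by (auto simp: star_subalgebra_def)
  obtain v where v: "v \<in> E" "v \<noteq> 0" "\<And>x. x \<in> E \<Longrightarrow> \<exists>c. x * v = c *\<^sub>C v"
    using joint_eigenvector_exists[OF sub assms(2-5)] by blast
  define w where "w = star v * v"
  have w: "w \<in> E" "w \<noteq> 0" "star w = w"
    using v star by (simp_all add: w_def complex_subalgebraD(5)[OF sub] star_mult star_star)
  have w_eig: "\<exists>c. x * w = c *\<^sub>C w" if "x \<in> E" for x
  proof -
    obtain c where "x * v = c *\<^sub>C v"
      using v(3) \<open>x \<in> E\<close> by blast
    moreover have "x * w = star v * (x * v)"
      using ab \<open>x \<in> E\<close> v(1) star by (metis abelian_def mult.assoc w_def)
    ultimately show ?thesis
      by (auto simp: w_def mult_scaleC_right)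
  qed
  then obtain c where c: "w * w = c *\<^sub>C w"
    using w(1) by blast
  have "w * w \<noteq> 0"
    using w star_mult_self_eq_0_iff[of w] by simp
  with c have "c \<noteq> 0"
    by auto
  define r where "r = (1 / c) *\<^sub>C w"
  have "r \<in> E" "r \<noteq> 0"
    using w \<open>c \<noteq> 0\<close> by (simp_all add: r_def complex_subalgebraD(4)[OF sub])
  have idem: "r * r = r"
    using \<open>c \<noteq> 0\<close> by (simp add: r_def mult_scaleC_left mult_scaleC_right c scaleC_scaleC)
  have "star r * r = r * star r"
    using \<open>r \<in> E\<close> star ab by (auto simp: abelian_def)
  \<comment> \<open>A normal idempotent \<open>r\<close> equals \<open>star r * r\<close>: the difference has vanishing square.\<close>
  then have "star (r - star r * r) * (r - star r * r) = 0"
    using idem by (simp add: star_diff star_mult star_star algebra_simps)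
      (metis idem mult.assoc star_mult)
  then have "r = star r * r"
    by simp
  then have "star r = r"
    by (metis star_mult star_star)
  have "\<exists>d. x * r = d *\<^sub>C r" if "x \<in> E" for x
    using w_eig[OF that] by (metis r_def mult_scaleC_right scaleC_scaleC mult.commute)
  with idem \<open>star r = r\<close> \<open>r \<in> E\<close> \<open>r \<noteq> 0\<close> show ?thesis
    unfolding minimal_projection_def projection_def by blast
qed

lemma star_subalgebraD:
  assumes "star_subalgebra E"
  shows "complex_subalgebra E" and "x \<in> E \<Longrightarrow> star x \<in> E"
  using assms by (auto simp: star_subalgebra_def)

lemma projection_mult:
  assumes "projection p" and "projection d" and "p * d = d * p"
  shows "projection (p * d)"
proof -
  have "p * d * (p * d) = (p * p) * (d * d)"
    using assms(3) by (metis mult.assoc)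
  then show ?thesis
    using assms by (simp add: projection_def star_mult)
qed

lemma projection_diff:
  assumes "projection p" and "projection d" and "p * d = d" and "d * p = d"
  shows "projection (p - d)"
  using assms by (simp add: projection_def star_diff algebra_simps)

text \<open>
  Orthogonal nonzero projections are linearly independent, so there is an orthogonal family of minimal
  projections of largest cardinality.  If its sum were not a unit, the annihilator of the sum would be
  a nonzero algebra of the same kind and would contribute another minimal projection.
\<close>

lemma complete_family_of_minimal_projections:
  assumes E: "star_subalgebra E" and "finite_dimensional E" and ab: "abelian E"
  obtains P where "finite P" "\<And>r. r \<in> P \<Longrightarrow> minimal_projection r E" "projection (\<Sum>P)"
    "\<Sum>P \<in> E" "\<And>x. x \<in> E \<Longrightarrow> x * \<Sum>P = x"
proof -
  note sub = star_subalgebraD(1)[OF E]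
  obtain S where S: "finite S" "E \<subseteq> complex_vector.span S"
    using assms(2) by (auto simp: finite_dimensional_def)
  define good where "good P \<longleftrightarrow> finite P \<and> (\<forall>r\<in>P. minimal_projection r E) \<and>
      (\<forall>p\<in>P. \<forall>r\<in>P. p \<noteq> r \<longrightarrow> p * r = 0)" for P
  have sum_mult: "\<Sum>P * r = r" if "good P" "r \<in> P" for P r
  proof -
    have "\<Sum>P * r = (\<Sum>p\<in>P. p * r)"
      by (simp add: sum_distrib_right)
    also have "\<dots> = (\<Sum>p\<in>P. if p = r then r else 0)"
      using that by (intro sum.cong) (auto simp: good_def minimal_projection_def projection_def)
    finally show ?thesis
      using that by (simp add: good_def)
  qed
  have card_le: "card P \<le> card S" if "good P" for P
  proof -
    have "complex_vector.independent P"
    proof (rule complex_vector.independent_if_scalars_zero)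
      show "finite P" using that by (simp add: good_def)
      fix f r assume f: "(\<Sum>x\<in>P. f x *\<^sub>C x) = 0" and "r \<in> P"
      have "(\<Sum>x\<in>P. f x *\<^sub>C x) * r = (\<Sum>x\<in>P. f x *\<^sub>C (x * r))"
        by (simp add: sum_distrib_right mult_scaleC_left)
      also have "\<dots> = (\<Sum>x\<in>P. if x = r then f r *\<^sub>C r else 0)"
        using that \<open>r \<in> P\<close>
        by (intro sum.cong) (auto simp: good_def minimal_projection_def projection_def)
      also have "\<dots> = f r *\<^sub>C r"
        using that \<open>r \<in> P\<close> by (simp add: good_def)
      finally have "f r *\<^sub>C r = 0"
        using f by simp
      then show "f r = 0"
        using that \<open>r \<in> P\<close> by (auto simp: good_def minimal_projection_def)
    qed
    moreover have "P \<subseteq> E"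
      using that by (auto simp: good_def minimal_projection_def)
    ultimately show ?thesis
      using complex_vector.independent_span_bound[OF S(1)] S(2) by blast
  qed
  have "good {}"
    by (simp add: good_def)
  then obtain P where P: "good P" and max: "\<And>P'. good P' \<Longrightarrow> card P' \<le> card P"
    using ex_has_greatest_nat[of good "{}" card "Suc (card S)"] card_le by (auto simp: less_Suc_eq_le)
  have PE: "P \<subseteq> E"
    using P by (auto simp: good_def minimal_projection_def)
  define u where "u = \<Sum>P"
  have uE: "u \<in> E"
    unfolding u_def using PE sub
    by (auto simp: complex_subalgebra_def intro!: complex_vector.subspace_sum)
  have uu: "u * u = u"
    unfolding u_def sum_distrib_left[of _ "\<lambda>x. x"] by (intro sum.cong) (simp_all add: sum_mult[OF P])
  have "star u = u"
    unfolding u_def star_sum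
    using P by (intro sum.cong) (auto simp: good_def minimal_projection_def projection_def)
  have unit: "x * u = x" if "x \<in> E" for x
  proof (rule ccontr)
    assume "x * u \<noteq> x"
    define E' where "E' = {y \<in> E. y * u = 0}"
    have comm: "a * b = b * a" if "a \<in> E" "b \<in> E" for a b
      using that ab by (simp add: abelian_def)
    have "star y * u = 0" if "y \<in> E" "y * u = 0" for y
    proof -
      have "star (u * y) = 0"
        using that comm uE by simp
      then show ?thesis
        by (simp add: star_mult \<open>star u = u\<close>)
    qed
    moreover have "complex_subalgebra E'"
      using sub uE by (auto simp: E'_def complex_subalgebra_def complex_vector.subspace_def
          distrib_right mult_scaleC_left mult.assoc)
    ultimately have E': "star_subalgebra E'"
      using star_subalgebraD(2)[OF E] by (auto simp: star_subalgebra_def E'_def)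
    have "finite_dimensional E'" "abelian E'"
      using assms(2) ab by (auto simp: E'_def finite_dimensional_def abelian_def)
    moreover have "x - x * u \<in> E'"
      using that uE uu by (simp add: E'_def complex_subalgebraD[OF sub] left_diff_distrib mult.assoc)
    ultimately obtain r where r: "minimal_projection r E'"
      using minimal_projection_exists[OF E'] \<open>x * u \<noteq> x\<close> by (metis right_minus_eq)
    then have rE: "r \<in> E" "r * u = 0" "r * r = r" "r \<noteq> 0"
      by (auto simp: minimal_projection_def E'_def projection_def)
    have "\<exists>c. y * r = c *\<^sub>C r" if "y \<in> E" for y
    proof -
      have "y * r \<in> E'"
        using that rE by (simp add: E'_def complex_subalgebraD(5)[OF sub] mult.assoc)
      moreover have "y * r = (y * r) * r"
        using rE by (simp add: mult.assoc)
      ultimately show ?thesis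
        using r unfolding minimal_projection_def by metis
    qed
    then have "minimal_projection r E"
      using r rE by (auto simp: minimal_projection_def)
    moreover have "r * p = 0" "p * r = 0" if "p \<in> P" for p
    proof -
      have "r * p = r * (u * p)"
        using sum_mult[OF P that] by (simp add: u_def)
      then show "r * p = 0"
        using rE by (simp flip: mult.assoc)
      then show "p * r = 0"
        using comm rE(1) PE that by auto
    qed
    ultimately have "good (insert r P)"
      using P by (auto simp: good_def)
    moreover have "r \<notin> P"
      using \<open>\<And>p. p \<in> P \<Longrightarrow> r * p = 0\<close> rE by force
    ultimately show False
      using max[of "insert r P"] P by (simp add: good_def)
  qed
  show thesis
    using P uE uu \<open>star u = u\<close> unit
    by (intro that[of P]) (auto simp: good_def u_def projection_def)
qed

text \<open>
  Maximality is tested against the double commutant of \<open>D \<union> {x}\<close> within \<open>C\<close>.  It is a selfadjoint algebra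
  because the commutant of a selfadjoint set is one, and it is abelian because \<open>D \<union> {x}\<close> is contained in
  its own commutant.
\<close>

lemma masa_contains_commuting_selfadjoint:
  assumes masa: "masa D C" and C: "star_subalgebra C"
    and x: "x \<in> C" "star x = x" "\<And>d. d \<in> D \<Longrightarrow> d * x = x * d"
  shows "x \<in> D"
proof -
  have D: "D \<subseteq> C" "star_subalgebra D" "abelian D"
    and max: "\<And>E. E \<subseteq> C \<Longrightarrow> star_subalgebra E \<Longrightarrow> abelian E \<Longrightarrow> D \<subseteq> E \<Longrightarrow> E = D"
    using masa by (auto simp: masa_def)
  note sub = star_subalgebraD(1)[OF C]
  define Z where "Z = {z \<in> C. z * x = x * z \<and> (\<forall>d\<in>D. z * d = d * z)}"
  define E where "E = {y \<in> C. \<forall>z\<in>Z. y * z = z * y}"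
  have star_Z: "star z \<in> Z" if "z \<in> Z" for z
  proof -
    have "star z * d = d * star z" if "d \<in> D" for d
    proof -
      have "z * star d = star d * z"
        using \<open>z \<in> Z\<close> star_subalgebraD(2)[OF D(2) that] unfolding Z_def by blast
      from arg_cong[OF this, of star] show ?thesis
        by (simp add: star_mult star_star)
    qed
    moreover have "z * x = x * z"
      using \<open>z \<in> Z\<close> unfolding Z_def by blast
    from arg_cong[OF this, of star] have "star z * x = x * star z"
      by (simp add: star_mult x(2))
    moreover have "star z \<in> C"
      using \<open>z \<in> Z\<close> star_subalgebraD(2)[OF C] unfolding Z_def by blast
    ultimately show ?thesis
      unfolding Z_def by blast
  qed
  have "star_subalgebra E"
    unfolding star_subalgebra_def complex_subalgebra_def complex_vector.subspace_def
  proof (intro conjI ballI allI)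
    show "0 \<in> E"
      by (simp add: E_def complex_subalgebraD[OF sub])
    fix y y' assume "y \<in> E" "y' \<in> E"
    then show "y + y' \<in> E"
      by (simp add: E_def complex_subalgebraD[OF sub] distrib_left distrib_right)
    have "y * y' * z = z * (y * y')" if "z \<in> Z" for z
    proof -
      have "y * z = z * y" "y' * z = z * y'"
        using \<open>y \<in> E\<close> \<open>y' \<in> E\<close> that unfolding E_def by blast+
      then show ?thesis
        by (metis mult.assoc)
    qed
    then show "y * y' \<in> E"
      using \<open>y \<in> E\<close> \<open>y' \<in> E\<close> by (simp add: E_def complex_subalgebraD[OF sub])
  next
    fix c y assume "y \<in> E"
    then show "c *\<^sub>C y \<in> E"
      by (simp add: E_def complex_subalgebraD[OF sub] mult_scaleC_left mult_scaleC_right)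
  next
    fix y assume "y \<in> E"
    have "star y * z = z * star y" if "z \<in> Z" for z
    proof -
      have "y * star z = star z * y"
        using \<open>y \<in> E\<close> star_Z[OF that] unfolding E_def by blast
      from arg_cong[OF this, of star] show ?thesis
        by (simp add: star_mult star_star)
    qed
    then show "star y \<in> E"
      using \<open>y \<in> E\<close> star_subalgebraD(2)[OF C] by (simp add: E_def)
  qed
  moreover have "D \<subseteq> E" "x \<in> E"
    using D(1) x(1) by (auto simp: E_def Z_def)
  moreover have "E \<subseteq> C"
    by (auto simp: E_def)
  moreover have "abelian E"
  proof -
    have "D \<subseteq> Z" "x \<in> Z"
      using D x by (auto simp: Z_def abelian_def)
    then have "E \<subseteq> Z"
      by (auto simp: E_def Z_def)
    then show ?thesis
      by (auto simp: abelian_def E_def)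
  qed
  ultimately show ?thesis
    using max[of E] by auto
qed

text \<open>
  A selfadjoint element of the corner \<open>r C r\<close> commutes with \<open>D\<close>, because \<open>D\<close> acts on \<open>r\<close> by scalars; so it
  belongs to \<open>D\<close> and is itself a multiple of \<open>r\<close>.  The general case follows by splitting into real
  and imaginary parts.
\<close>

lemma minimal_projection_compression:
  assumes masa: "masa D C" and C: "star_subalgebra C" and r: "minimal_projection r D" and "x \<in> C"
  shows "\<exists>c. r * x * r = c *\<^sub>C r"
proof -
  have D: "D \<subseteq> C" "abelian D"
    using masa by (auto simp: masa_def)
  have rD: "r \<in> D" "r * r = r" "star r = r" and eig: "\<And>d. d \<in> D \<Longrightarrow> \<exists>c. d * r = c *\<^sub>C r"
    using r by (auto simp: minimal_projection_def projection_def)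
  note sub = star_subalgebraD(1)[OF C]
  have sa: "\<exists>c. h = c *\<^sub>C r" if h: "h \<in> C" "star h = h" "r * h = h" "h * r = h" for h
  proof -
    have "d * h = h * d" if "d \<in> D" for d
    proof -
      obtain c where "d * r = c *\<^sub>C r"
        using eig[OF \<open>d \<in> D\<close>] by blast
      moreover from this have "r * d = c *\<^sub>C r"
        using D(2) rD(1) \<open>d \<in> D\<close> by (simp add: abelian_def)
      moreover have "d * h = (d * r) * h" "h * d = h * (r * d)"
        using h by (simp_all add: mult.assoc) (simp flip: mult.assoc add: h)
      ultimately show ?thesis
        using h by (simp add: mult_scaleC_left mult_scaleC_right)
    qed
    then have "h \<in> D"
      using masa_contains_commuting_selfadjoint[OF masa C] h by blast
    then show ?thesis
      using eig h(4) by metis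
  qed
  define z where "z = r * x * r"
  have z: "z \<in> C" "r * z = z" "z * r = z" "r * star z = star z" "star z * r = star z"
    using \<open>x \<in> C\<close> rD D
    by (auto simp: z_def complex_subalgebraD(5)[OF sub] star_mult mult.assoc)
      (simp_all add: rD flip: mult.assoc)
  note zs = star_subalgebraD(2)[OF C z(1)]
  \<comment> \<open>\<open>sa\<close> is applied to twice the real part, and to \<open>- 2\<close> times the imaginary part, of \<open>z\<close>.\<close>
  obtain a where a: "z + star z = a *\<^sub>C r"
    using sa[of "z + star z"] z zs
    by (auto simp: complex_subalgebraD(2)[OF sub] star_add star_star distrib_left distrib_right add.commute)
  obtain b where b: "\<i> *\<^sub>C (z - star z) = b *\<^sub>C r"
    using sa[of "\<i> *\<^sub>C (z - star z)"] z zs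
    by (auto simp: complex_subalgebraD[OF sub] star_diff star_scaleC star_star
        left_diff_distrib right_diff_distrib mult_scaleC_left mult_scaleC_right
        complex_vector.scale_right_diff_distrib)
  have "z - star z = (- \<i> * b) *\<^sub>C r"
    using arg_cong[OF b, of "\<lambda>y. (- \<i>) *\<^sub>C y"] by (simp add: scaleC_scaleC scaleC_one)
  with a have "z + z = (a - \<i> * b) *\<^sub>C r"
    by (simp add: complex_vector.scale_left_diff_distrib algebra_simps)
  then have "z = ((a - \<i> * b) / 2) *\<^sub>C r"
  proof -
    assume *: "z + z = (a - \<i> * b) *\<^sub>C r"
    have "z = (1/2) *\<^sub>C (z + z)"
      by (simp add: scaleC_add_right scaleC_one flip: scaleC_add_left)
    then show ?thesis
      unfolding * by (simp add: scaleC_scaleC)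
  qed
  then show ?thesis
    unfolding z_def by blast
qed

text \<open>
  The defect \<open>z = y - y u\<close> is annihilated by \<open>D\<close> from the right, so \<open>z\<^sup>* z\<close> commutes with \<open>D\<close>.  Hence
  \<open>z\<^sup>* z\<close> is in \<open>D\<close>, where \<open>u\<close> acts as a unit although it annihilates \<open>z\<close>.
\<close>

lemma masa_unit_is_unit:
  assumes masa: "masa D C" and C: "star_subalgebra C"
    and u: "u \<in> D" "star u = u" "\<And>d. d \<in> D \<Longrightarrow> d * u = d" and "x \<in> C"
  shows "x * u = x" and "u * x = x"
proof -
  have D: "D \<subseteq> C" "abelian D"
    using masa by (auto simp: masa_def)
  note sub = star_subalgebraD(1)[OF C]
  have *: "y * u = y" if "y \<in> C" for y
  proof -
    define z where "z = y - y * u"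
    have "z \<in> C"
      using that u(1) D by (auto simp: z_def complex_subalgebraD[OF sub])
    have uu: "u * u = u"
      using u by blast
    have zd: "z * d = 0" if "d \<in> D" for d
    proof -
      have "u * d = d"
        using u D that by (metis abelian_def)
      then show ?thesis
        by (simp add: z_def left_diff_distrib mult.assoc)
    qed
    have dz: "d * star z = 0" if "d \<in> D" for d
    proof -
      have "star d \<in> D"
        using that masa by (auto simp: masa_def star_subalgebra_def)
      then have "star (z * star d) = 0"
        using zd by simp
      then show ?thesis by (simp add: star_mult star_star)
    qed
    have "star z * z \<in> D"
    proof (rule masa_contains_commuting_selfadjoint[OF masa C])
      show "star z * z \<in> C"
        using \<open>z \<in> C\<close> star_subalgebraD[OF C] by (simp add: complex_subalgebraD)
      show "star (star z * z) = star z * z"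
        by (simp add: star_mult star_star)
      show "d * (star z * z) = star z * z * d" if "d \<in> D" for d
        using zd[OF that] dz[OF that] by (simp add: mult.assoc) (simp flip: mult.assoc)
    qed
    then have "star z * z = star z * z * u"
      using u(3) by simp
    also have "\<dots> = 0"
      using zd[OF u(1)] by (simp add: mult.assoc)
    finally show ?thesis
      by (simp add: z_def)
  qed
  show "x * u = x"
    using * \<open>x \<in> C\<close> by blast
  have "star (star x * u) = star (star x)"
    using * \<open>x \<in> C\<close> star_subalgebraD(2)[OF C] by simp
  then show "u * x = x"
    by (simp add: star_mult star_star u(2))
qed

section \<open>Unsplittable elements\<close>

lemma closed_complex_line: "closed (range (\<lambda>a. a *\<^sub>C (v :: 'a::cstar_algebra)))"
proof (cases "v = 0")
  case False
  have "bounded_linear (\<lambda>a. a *\<^sub>C v)"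
  proof (rule bounded_linear_intro[where K = "norm v"])
    show "(r *\<^sub>R a) *\<^sub>C v = r *\<^sub>R (a *\<^sub>C v)" for r :: real and a
      by (simp add: scaleR_conv_of_real scaleC_scaleC flip: scaleC_of_real)
  qed (simp_all add: scaleC_add_left norm_scaleC)
  then have "complete ((\<lambda>a. a *\<^sub>C v) ` UNIV)"
    using False
    by (intro complete_isometric_image[where e = "norm v"]) (auto simp: norm_scaleC mult.commute complete_UNIV)
  then show ?thesis
    by (rule complete_imp_closed)
qed (simp add: image_constant_conv)

lemma nested_closure_tail:
  fixes C :: "nat \<Rightarrow> 'a::topological_space set"
  assumes "\<And>k. C k \<subseteq> C (Suc k)" and "x \<in> closure (\<Union>k. C k)"
  shows "x \<in> closure (\<Union>j\<in>{l..}. C j)"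
proof -
  have "C k \<subseteq> (\<Union>j\<in>{l..}. C j)" for k
    using lift_Suc_mono_le[of C k "max k l"] assms(1) by fastforce
  then show ?thesis
    using closure_mono[of "\<Union>k. C k" "\<Union>j\<in>{l..}. C j"] assms(2) by blast
qed

text \<open>
  This provides a nonzero compression to start from: \<open>c\<close> is an approximant of \<open>t\<close> in a finite stage and \<open>u\<close>
  is the unit of that stage.
\<close>

lemma compression_by_approximate_unit_nonzero:
  assumes "projection u" and "u * c = c" and "c * u = c" and "norm (t - c) < norm t / 2"
  shows "u * t * u \<noteq> 0"
proof
  assume 0: "u * t * u = 0"
  have "u * (t - c) * u = - c"
    using 0 assms(2,3) by (simp add: left_diff_distrib right_diff_distrib)
  then have "norm c \<le> norm (t - c)"
    using norm_compress_le[OF assms(1) assms(1), of "t - c"] by simp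
  moreover have "norm t \<le> norm (t - c) + norm c"
    using norm_triangle_ineq[of "t - c" c] by simp
  ultimately show False
    using assms(4) by simp
qed

text \<open>
  If \<open>c\<^sup>* c\<close> is a multiple of \<open>r\<close>, then \<open>c\<close> has the same norm on every nonzero subprojection \<open>d\<close> of \<open>r\<close>.
  Where \<open>t\<close> vanishes, this norm is that of \<open>(t - c) d\<close>, too small for an approximant of \<open>t\<close>.
\<close>

lemma no_small_subprojection:
  assumes r: "projection r" and c: "star c * c = a *\<^sub>C r" and near: "norm (t - c) < norm t / 2"
    and d: "projection d" "d * r = d" "t * d = 0"
  shows "d = 0"
proof (rule ccontr)
  assume "d \<noteq> 0"
  then have "r \<noteq> 0"
    using d(2) by auto
  have "star (c * d) * (c * d) = d * (star c * c) * d"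
    using d(1) by (simp add: star_mult projection_def mult.assoc)
  also have "\<dots> = a *\<^sub>C d"
    using d by (simp add: c mult_scaleC_left mult_scaleC_right projection_def)
  finally have "(norm (c * d))\<^sup>2 = cmod a"
    using norm_projection[OF d(1) \<open>d \<noteq> 0\<close>] by (simp flip: cstar_identity add: norm_scaleC)
  moreover have "(norm c)\<^sup>2 = cmod a"
    using norm_projection[OF r \<open>r \<noteq> 0\<close>] c by (simp flip: cstar_identity add: norm_scaleC)
  ultimately have "norm c = norm (c * d)"
    by (metis norm_ge_zero power2_eq_imp_eq)
  also have "\<dots> = norm ((t - c) * d)"
    using d(3) by (simp add: left_diff_distrib)
  also have "\<dots> \<le> norm (t - c)"
    using norm_mult_projection_le[OF d(1)] .
  finally show False
    using near norm_triangle_ineq[of "t - c" c] by simp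
qed

text \<open>
  Some minimal projection \<open>p\<close> of \<open>E\<close> meets \<open>r\<close>.  As \<open>t\<close> annihilates no nonzero subprojection of \<open>r\<close>, it
  does not annihilate \<open>r p\<close>, so \<open>t (r p) = t\<close>.  Then \<open>t\<close> annihilates \<open>r - r p\<close>, which must vanish, and \<open>r\<close>
  is a multiple of \<open>p\<close>.
\<close>

lemma atom_support_minimal:
  assumes E: "star_subalgebra E" "finite_dimensional E" "abelian E"
    and r: "r \<in> E" "projection r" "r \<noteq> 0" "t * r = t"
    and c: "star c * c = a *\<^sub>C r" and near: "norm (t - c) < norm t / 2"
    and atom: "\<And>d. d \<in> E \<Longrightarrow> projection d \<Longrightarrow> t * d = 0 \<or> t * d = t"
  shows "minimal_projection r E"
proof -
  have comm: "x * y = y * x" if "x \<in> E" "y \<in> E" for x y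
    using that E(3) by (simp add: abelian_def)
  obtain P where P: "\<And>p. p \<in> P \<Longrightarrow> minimal_projection p E" "\<And>x. x \<in> E \<Longrightarrow> x * \<Sum>P = x"
    using complete_family_of_minimal_projections[OF E] by metis
  have "\<exists>p\<in>P. r * p \<noteq> 0"
  proof (rule ccontr)
    assume "\<not> ?thesis"
    then have "r * \<Sum>P = 0"
      by (simp add: sum_distrib_left)
    then show False
      using P(2) r by simp
  qed
  then obtain p where p: "p \<in> P" "r * p \<noteq> 0"
    by blast
  have pE: "p \<in> E" "projection p" and eig: "\<And>x. x \<in> E \<Longrightarrow> \<exists>c. x * p = c *\<^sub>C p"
    using P(1)[OF p(1)] by (auto simp: minimal_projection_def)
  define d where "d = r * p"
  have rr: "r * r = r"
    using r by (simp add: projection_def)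
  have d: "d \<in> E" "projection d" "r * d = d"
    using projection_mult[OF r(2) pE(2) comm[OF r(1) pE(1)]] r(1) pE(1) rr
      complex_subalgebraD(5)[OF star_subalgebraD(1)[OF E(1)]]
    by (simp_all add: d_def flip: mult.assoc)
  then have dr: "d * r = d"
    using comm[OF d(1) r(1)] by simp
  have "t * d \<noteq> 0"
    using no_small_subprojection[OF r(2) c near d(2) dr] p(2) by (auto simp: d_def)
  then have "t * d = t"
    using atom d by blast
  then have "r - d = 0"
    using no_small_subprojection[OF r(2) c near projection_diff[OF r(2) d(2,3) dr]] r(4) dr rr
    by (simp add: left_diff_distrib right_diff_distrib)
  then obtain b where b: "r = b *\<^sub>C p"
    using eig[OF r(1)] by (auto simp: d_def)
  have "\<exists>a. x * r = a *\<^sub>C r" if "x \<in> E" for x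
    using eig[OF that] by (auto simp: b mult_scaleC_right scaleC_scaleC mult.commute)
  then show ?thesis
    using r by (simp add: minimal_projection_def)
qed

text \<open>
  For \<open>x\<close> in a late stage, \<open>e\<^sup>* x r\<close> is in the corner \<open>r C\<^sub>j r\<close>, hence a multiple of \<open>r\<close>; multiplying by \<open>e\<close>
  on the left, and using that \<open>e e\<^sup>*\<close> is a nonzero multiple of \<open>q\<close>, puts \<open>q x r\<close> on the line spanned by \<open>e\<close>.
  Lines are closed, so the same holds for the closure, including for \<open>t\<close> itself.
\<close>

lemma atom_corner_one_dimensional:
  fixes t :: "'a::cstar_algebra"
  assumes C: "\<And>k. star_subalgebra (C k)" "\<And>k. finite_dimensional (C k)" "\<And>k. C k \<subseteq> C (Suc k)"
    and D: "\<And>k. masa (D k) (C k)" "\<And>k. D k \<subseteq> D (Suc k)"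
    and t: "t \<in> closure (\<Union>k. C k)" "t \<noteq> 0"
    and atom: "\<And>k d. d \<in> D k \<Longrightarrow> projection d \<Longrightarrow> d * t = 0 \<or> d * t = t"
      "\<And>k d. d \<in> D k \<Longrightarrow> projection d \<Longrightarrow> t * d = 0 \<or> t * d = t"
  obtains q r k where "q \<in> D k" "r \<in> D k" "q * t = t" "t * r = t"
    and "\<forall>x\<in>closure (\<Union>k. C k). \<exists>a. q * x * r = a *\<^sub>C t"
proof -
  have D': "D k \<subseteq> C k" "star_subalgebra (D k)" "abelian (D k)" "finite_dimensional (D k)" for k
    using D(1)[of k] C(2)[of k] by (auto simp: masa_def finite_dimensional_def)
  have mulC: "x * y \<in> C k" if "x \<in> C k" "y \<in> C k" for x y k
    using that by (rule complex_subalgebraD(5)[OF star_subalgebraD(1)[OF C(1)]])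
  have starC: "star x \<in> C k" if "x \<in> C k" for x k
    using that by (rule star_subalgebraD(2)[OF C(1)])
  obtain c l where cl: "c \<in> C l" "norm (t - c) < norm t / 2"
    using t closure_approachable[of t "\<Union>k. C k"]
    by (metis UN_E dist_norm dist_commute half_gt_zero zero_less_norm_iff)
  obtain P where P: "\<And>p. p \<in> P \<Longrightarrow> minimal_projection p (D l)" "projection (\<Sum>P)" "\<Sum>P \<in> D l"
      "\<And>x. x \<in> D l \<Longrightarrow> x * \<Sum>P = x"
    using complete_family_of_minimal_projections[OF D'(2,4,3), of l] by metis
  have "\<Sum>P * c = c" "c * \<Sum>P = c"
    using masa_unit_is_unit[OF D(1) C(1) P(3) _ P(4) cl(1)] P(2) by (auto simp: projection_def)
  then have "\<Sum>P * t * \<Sum>P \<noteq> 0"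
    using compression_by_approximate_unit_nonzero[OF P(2) _ _ cl(2)] by blast
  moreover have "\<Sum>P * t * \<Sum>P = (\<Sum>q\<in>P. \<Sum>r\<in>P. q * t * r)"
    by (simp only: sum_distrib_right[of "\<lambda>x. x"] sum_product)
  ultimately have "\<not> (\<forall>q\<in>P. \<forall>r\<in>P. q * t * r = 0)"
    by (metis (no_types, lifting) sum.neutral)
  then obtain q r where qr: "q \<in> P" "r \<in> P" "q * t * r \<noteq> 0"
    by blast
  have q: "q \<in> D l" "projection q" "q \<noteq> 0" and r: "r \<in> D l" "projection r" "r \<noteq> 0"
    using P(1) qr by (auto simp: minimal_projection_def)
  have qt: "q * t = t" and tr: "t * r = t"
    using atom(1)[OF q(1,2)] atom(2)[OF r(1,2)] qr(3) by (auto simp: mult.assoc)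
  define e where "e = q * c * r"
  have qC: "q \<in> C l" "r \<in> C l"
    using q r D'(1) by auto
  have qq: "q * q = q" "star q = q" "\<And>y. q * (q * y) = q * y"
    and rr: "r * r = r" "star r = r" "\<And>y. r * (r * y) = r * y"
    using q(2) r(2) by (simp_all add: projection_def flip: mult.assoc)
  have e: "e \<in> C l" "q * e = e" "e * r = e"
    using cl(1) qC by (simp_all add: e_def mulC mult.assoc qq rr)
  have near: "norm (t - e) < norm t / 2"
  proof -
    have "t - e = q * (t - c) * r"
      using qt tr by (simp add: e_def left_diff_distrib right_diff_distrib)
    then show ?thesis
      using norm_compress_le[OF q(2) r(2), of "t - c"] cl(2) by simp
  qed
  have "e \<noteq> 0"
    using near t(2) by auto
  have "star e * e = r * (star c * q * c) * r"
    by (simp add: e_def star_mult mult.assoc qq rr)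
  moreover have "star c * q * c \<in> C l"
    using cl(1) qC by (intro mulC starC)
  ultimately obtain a where a: "star e * e = a *\<^sub>C r"
    using minimal_projection_compression[OF D(1) C(1) P(1)[OF qr(2)]] by metis
  have "e * star e = q * (c * r * star c) * q"
    by (simp add: e_def star_mult mult.assoc qq rr)
  moreover have "c * r * star c \<in> C l"
    using cl(1) qC by (intro mulC starC)
  ultimately obtain b where b: "e * star e = b *\<^sub>C q"
    using minimal_projection_compression[OF D(1) C(1) P(1)[OF qr(1)]] by metis
  have "b \<noteq> 0"
    using b \<open>e \<noteq> 0\<close> star_mult_self_eq_0_iff[of "star e"] by (auto simp: star_star)
  have rj: "minimal_projection r (D j)" if "l \<le> j" for j
  proof (rule atom_support_minimal[OF D'(2,4,3) _ r(2,3) tr a near atom(2)])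
    show "r \<in> D j"
      using lift_Suc_mono_le[of D l j] D(2) that r(1) by auto
  qed
  have "q * x * r \<in> range (\<lambda>a. a *\<^sub>C e)" if "l \<le> j" "x \<in> C j" for x j
  proof -
    have "C l \<subseteq> C j"
      using lift_Suc_mono_le[of C l j] C(3) that by auto
    then have "star e * x \<in> C j"
      using e(1) that(2) by (intro mulC starC) auto
    then obtain d where d: "r * (star e * x) * r = d *\<^sub>C r"
      using minimal_projection_compression[OF D(1) C(1) rj[OF \<open>l \<le> j\<close>]] by blast
    have "b *\<^sub>C (q * x * r) = e * star e * x * r"
      by (simp add: b mult_scaleC_left)
    also have "\<dots> = e * (r * (star e * x) * r)"
      by (simp add: e(3) flip: mult.assoc)
    also have "\<dots> = d *\<^sub>C e"
      by (simp add: d mult_scaleC_right e(3))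
    finally have "(1 / b) *\<^sub>C (b *\<^sub>C (q * x * r)) = (1 / b) *\<^sub>C (d *\<^sub>C e)"
      by simp
    then have "q * x * r = (1 / b * d) *\<^sub>C e"
      using \<open>b \<noteq> 0\<close> by (simp add: scaleC_scaleC scaleC_one)
    then show ?thesis by blast
  qed
  then have "(\<Union>j\<in>{l..}. C j) \<subseteq> (\<lambda>x. q * x * r) -` range (\<lambda>a. a *\<^sub>C e)"
    by auto
  then have "closure (\<Union>j\<in>{l..}. C j) \<subseteq> (\<lambda>x. q * x * r) -` range (\<lambda>a. a *\<^sub>C e)"
    by (rule closure_minimal) (intro closed_vimage closed_complex_line continuous_intros)
  then have line: "\<exists>a. q * x * r = a *\<^sub>C e" if "x \<in> closure (\<Union>k. C k)" for x
    using nested_closure_tail[OF C(3) that, of l] by auto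
  then obtain h where h: "t = h *\<^sub>C e"
    using t(1) qt tr by metis
  then have "h \<noteq> 0"
    using t(2) by auto
  have "\<exists>a. q * x * r = a *\<^sub>C t" if x: "x \<in> closure (\<Union>k. C k)" for x
  proof -
    obtain a where "q * x * r = a *\<^sub>C e"
      using line[OF x] by blast
    then have "q * x * r = (a / h) *\<^sub>C t"
      using \<open>h \<noteq> 0\<close> by (simp add: h scaleC_scaleC)
    then show ?thesis by blast
  qed
  then show thesis
    using that q(1) r(1) qt tr by blast
qed

text \<open>
  The corner of \<open>B\<close> containing \<open>t\<close> corresponds under \<open>\<phi>\<close> to a line in \<open>A\<close>, and the scalars \<open>h n\<close> that
  describe the compressed null sequence are the same on both sides.
\<close>

lemma separating_space_no_one_dimensional_corner:
  fixes \<phi> :: "'a::cstar_algebra \<Rightarrow> 'b::cstar_algebra"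
  assumes A: "complex_subalgebra A" and iso: "algebraic_isomorphism \<phi> A B"
    and t: "t \<in> separating_space \<phi> A" "t \<in> B" and q: "q \<in> B" "q * t = t" and r: "r \<in> B" "t * r = t"
    and line: "\<And>b. b \<in> B \<Longrightarrow> \<exists>a. q * b * r = a *\<^sub>C t"
  shows "t = 0"
proof (rule ccontr)
  assume "t \<noteq> 0"
  note hom = algebraic_isomorphismD(6)[OF iso] and mem = complex_subalgebraD(5)[OF A]
  obtain x where x: "\<And>n. x n \<in> A" "x \<longlonglongrightarrow> 0" "(\<lambda>n. \<phi> (x n)) \<longlonglongrightarrow> t"
    using t(1) by (rule separating_spaceE) blast
  obtain f g w where fgw: "f \<in> A" "\<phi> f = q" "g \<in> A" "\<phi> g = r" "w \<in> A" "\<phi> w = t"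
    using algebraic_isomorphismD(4)[OF iso] q(1) r(1) t(2) by metis
  have "w \<noteq> 0"
    using fgw \<open>t \<noteq> 0\<close> algebraic_isomorphism_zero[OF A iso] by auto
  have "\<exists>h. q * \<phi> (x n) * r = h *\<^sub>C t" for n
    using line algebraic_isomorphismD(3)[OF iso x(1)] by blast
  then obtain h where h: "\<And>n. q * \<phi> (x n) * r = h n *\<^sub>C t"
    by metis
  have "f * x n * g = h n *\<^sub>C w" for n
  proof (rule inj_onD[OF algebraic_isomorphismD(2)[OF iso]])
    show "\<phi> (f * x n * g) = \<phi> (h n *\<^sub>C w)"
      using fgw x(1) h by (simp add: hom mem algebraic_isomorphismD(7)[OF iso])
  qed (use fgw x(1) in \<open>simp_all add: mem complex_subalgebraD(4)[OF A]\<close>)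
  moreover have "(\<lambda>n. f * x n * g) \<longlonglongrightarrow> f * 0 * g"
    by (intro tendsto_intros x)
  ultimately have "(\<lambda>n. h n *\<^sub>C w) \<longlonglongrightarrow> 0"
    by simp
  then have "(\<lambda>n. norm (h n *\<^sub>C w) * (norm t / norm w)) \<longlonglongrightarrow> 0"
    by (intro tendsto_mult_left_zero tendsto_norm_zero)
  moreover have "norm (h n *\<^sub>C w) * (norm t / norm w) = norm (h n *\<^sub>C t)" for n
    using \<open>w \<noteq> 0\<close> by (simp add: norm_scaleC)
  ultimately have "(\<lambda>n. norm (h n *\<^sub>C t)) \<longlonglongrightarrow> 0"
    by simp
  then have "(\<lambda>n. h n *\<^sub>C t) \<longlonglongrightarrow> 0"
    by (rule tendsto_norm_zero_cancel)
  moreover have "(\<lambda>n. q * \<phi> (x n) * r) \<longlonglongrightarrow> q * t * r"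
    by (intro tendsto_intros x)
  ultimately have "q * t * r = 0"
    using h LIMSEQ_unique by simp
  then show False
    using q r \<open>t \<noteq> 0\<close> by simp
qed

section \<open>Automatic continuity\<close>

theorem theorem1p4:
  fixes A :: "'a::cstar_algebra set" and B :: "'b::cstar_algebra set" and \<phi> :: "'a \<Rightarrow> 'b"
  assumes "limit_algebra A" and "limit_algebra B"
    and "algebraic_isomorphism \<phi> A B"
  shows "continuous_on A \<phi>"
proof -
  have A: "complex_subalgebra A" "closed A" and B: "complex_subalgebra B" "closed B"
    using assms(1,2) by (auto simp: limit_algebra_def)
  note iso = assms(3)
  obtain C D where "B \<subseteq> C" "canonical_masa D C" "D \<subseteq> B"
    using assms(2) unfolding limit_algebra_def by blast
  then obtain Ck where seq: "AF_sequence Ck C" and mk: "\<And>k. masa (Ck k \<inter> D) (Ck k)"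
    and "abelian D"
    unfolding canonical_masa_def masa_def[of D C] by blast
  define Dk where "Dk k = Ck k \<inter> D" for k
  have Ck: "star_subalgebra (Ck k)" "finite_dimensional (Ck k)" "Ck k \<subseteq> Ck (Suc k)"
    and C: "C = closure (\<Union>k. Ck k)" for k
    using seq by (auto simp: AF_sequence_def cstar_subalgebra_def)
  have Dk: "masa (Dk k) (Ck k)" "Dk k \<subseteq> Dk (Suc k)" "Dk k \<subseteq> B" "star_subalgebra (Dk k)"
    "abelian (Dk k)" "finite_dimensional (Dk k)" for k
    using mk[of k] Ck(2,3)[of k] \<open>D \<subseteq> B\<close>
    by (auto simp: Dk_def masa_def finite_dimensional_def)
  have D_comm: "p * d = d * p" if "p \<in> Dk k" "d \<in> Dk j" for p d k j
    using that \<open>abelian D\<close> by (auto simp: Dk_def abelian_def)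
  \<comment> \<open>Splitting uses projections of the finite stages only; \<open>Q\<close> is closed under products and
    complements because the stages are nested.\<close>
  define Q where "Q = {p. projection p \<and> (\<exists>k. p \<in> Dk k)}"
  have QB: "p \<in> B" if "p \<in> Q" for p
    using that Dk(3) by (auto simp: Q_def)
  have Q_comm: "p * d = d * p" if "p \<in> Q" "d \<in> Q" for p d
    using that D_comm by (auto simp: Q_def)
  have Q_mult: "p * d \<in> Q" and Q_diff: "p - p * d \<in> Q" if pd: "p \<in> Q" "d \<in> Q" for p d
  proof -
    obtain j k where "p \<in> Dk j" "d \<in> Dk k"
      using pd by (auto simp: Q_def)
    then have "p \<in> Dk (max j k)" "d \<in> Dk (max j k)"
      using lift_Suc_mono_le[of Dk _ "max j k"] Dk(2) by (meson max.cobounded1 max.cobounded2 subsetD)+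
    then have "p * d \<in> Dk (max j k)" "p - p * d \<in> Dk (max j k)"
      using star_subalgebraD(1)[OF Dk(4)] by (simp_all add: complex_subalgebraD)
    moreover have pr: "projection p" "projection (p * d)"
      using pd Q_comm[OF pd] by (auto simp: Q_def projection_mult)
    moreover have "p * (p * d) = p * d" "p * d * p = p * d"
      using pr(1) Q_comm[OF pd] by (simp_all add: projection_def mult.assoc flip: Q_comm[OF pd])
        (simp_all add: projection_def flip: mult.assoc)
    ultimately show "p * d \<in> Q" "p - p * d \<in> Q"
      using projection_diff[OF pr] by (auto simp: Q_def)
  qed
  have Q_proj: "projection p" if "p \<in> Q" for p
    using that by (simp add: Q_def)
  have sep: "separating_space \<phi> A \<subseteq> {0}"
  proof (rule ccontr)
    assume "\<not> ?thesis"
    then obtain s where s: "s \<in> separating_space \<phi> A" "s \<noteq> 0"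
      by blast
    have sep_B: "t \<in> B" if "t \<in> separating_space \<phi> A" for t
      using that closed_sequentially[OF B(2)] algebraic_isomorphismD(3)[OF iso]
      by (metis separating_spaceE)
    have "s \<in> closure (\<Union>k. Ck k)"
      using sep_B[OF s(1)] \<open>B \<subseteq> C\<close> C by auto
    then obtain c l where c: "c \<in> Ck l" "norm (s - c) < norm s / 2"
      using s(2) closure_approachable[of s "\<Union>k. Ck k"]
      by (metis UN_E dist_norm dist_commute half_gt_zero zero_less_norm_iff)
    obtain P where P: "projection (\<Sum>P)" "\<Sum>P \<in> Dk l" "\<And>x. x \<in> Dk l \<Longrightarrow> x * \<Sum>P = x"
      using complete_family_of_minimal_projections[OF Dk(4,6,5), of l] by metis
    have "\<Sum>P * c = c" "c * \<Sum>P = c"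
      using masa_unit_is_unit[OF Dk(1) Ck(1) P(2) _ P(3) c(1)] P(1) by (auto simp: projection_def)
    then have start: "\<Sum>P * s * \<Sum>P \<noteq> 0"
      using compression_by_approximate_unit_nonzero[OF P(1) _ _ c(2)] by blast
    have "\<Sum>P \<in> Q"
      using P(1,2) by (auto simp: Q_def)
    have hump: "\<exists>n::nat. q n * s * p n = 0"
      if "\<And>n. q n \<in> Q" "\<And>n. p n \<in> Q" "\<And>m n. m \<noteq> n \<Longrightarrow> q m * q n = 0 \<or> p m * p n = 0" for q p
      using that QB by (intro gliding_hump[OF A iso s(1)]) (auto simp: Q_def)
    obtain q p where qp: "q \<in> Q" "p \<in> Q" "q * s * p \<noteq> 0"
      and atom: "\<forall>d\<in>Q. d * (q * s * p) = 0 \<or> d * (q * s * p) = q * s * p"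
        "\<forall>d\<in>Q. (q * s * p) * d = 0 \<or> (q * s * p) * d = q * s * p"
      by (rule orthogonal_splitting_terminates[OF Q_proj Q_comm Q_mult Q_diff
          \<open>\<Sum>P \<in> Q\<close> \<open>\<Sum>P \<in> Q\<close> start hump]) blast
    define t where "t = q * s * p"
    have t: "t \<in> separating_space \<phi> A" "t \<noteq> 0"
      using separating_space_compress[OF A(1) iso s(1)] qp QB by (simp_all add: t_def)
    have tC: "t \<in> closure (\<Union>k. Ck k)"
      using sep_B[OF t(1)] \<open>B \<subseteq> C\<close> C by auto
    have atom_t: "d * t = 0 \<or> d * t = t" "t * d = 0 \<or> t * d = t" if "d \<in> Dk k" "projection d" for d k
      using atom that by (auto simp: Q_def t_def)
    obtain q' r' k where q': "q' \<in> Dk k" "q' * t = t" and r': "r' \<in> Dk k" "t * r' = t"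
      and line: "\<forall>x\<in>closure (\<Union>k. Ck k). \<exists>a. q' * x * r' = a *\<^sub>C t"
      by (rule atom_corner_one_dimensional[OF Ck Dk(1,2) tC t(2) atom_t]) blast+
    have "t = 0"
      using line q' r' Dk(3) \<open>B \<subseteq> C\<close> C
      by (intro separating_space_no_one_dimensional_corner[OF A(1) iso t(1) sep_B[OF t(1)], of q' r']) auto
    with t(2) show False by simp
  qed
  show ?thesis
    using A(2) complex_subalgebra_real_subspace[OF A(1)]
      algebraic_isomorphism_diff[OF A(1) iso] algebraic_isomorphismD(8)[OF iso] sep
    by (rule closed_graph_separating_space)
qed

end
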